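(* For any constants $L,M>0$ there exists a constant $C_1=C_1(L,M)>0$ such that the following holds. Let $\zeta=\zeta(x_1)\in L^\infty(S_+)$ be a function depending only on $x_1$ that is non-negative, non-increasing (in $x_1$) and compactly supported, with $$\operatorname{supp}(\zeta)\subset\{x_1<L\},\qquad \|\zeta\|_{L^\infty(S_+)}\le M .$$ Then for any non-negative $\omega_0\in L^\infty(S_+)$ with compact support, the corresponding solution $\omega(t)$ of the incompressible Euler equations in vorticity form on $S_+$ with initial data $\omega_0$ satisfies $$\sup_{t\ge 0}\|\omega(t)-\zeta\|_{J_1(S_+)}\le C_1\Big[\|\omega_0-\zeta\|_{J_1(S_+)}^{1/2}+\|\omega_0-\zeta\|_{J_1(S_+)}\Big].$$
   Context: Domain: $S_+=\mathbb{R}_{>0}\times\mathbb{T}$ is the half cylinder with points $x=(x_1,x_2)$, where $\mathbb{T}=[-\pi,\pi)$ is the torus ($2\pi$-periodic in $x_2$). "Compactly supported" means that the support is bounded (it may touch the wall $\{0\}\times\mathbb{T}$). The set $\{x_1<L\}$ means $\{x\in S_+:x_1<L\}$. Norm: $\|f\|_{J_1(S_+)}:=\int_{S_+}(1+x_1)|f(x)|\,dx$. Euler equations in vorticity form: $\partial_t\omega+u\cdot\nabla\omega=0$ on $(0,\infty)\times S_+$, $\omega|_{t=0}=\omega_0$, where $u$ is given by the cylindrical Biot–Savart law $$u(t,x)=\int_{S_+}K(x,y)\,\omega(t,y)\,dy,\qquad K(x,y)=K_S(x-y)-K_S(x+\bar y),\quad \bar y=(y_1,-y_2),$$ $$K_S(x)=\frac{(\sin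 x_2,\,-\sinh x_1)}{4\pi(\cosh x_1-\cos x_2)}$$ (so that $u_1=0$ on $\{x_1=0\}$ and $u\to0$ as $x_1\to\infty$). Solution: for $\omega_0\in L^\infty(S_+)$ with bounded support there is a unique global-in-time (Yudovich) weak solution $\omega\in L^\infty(0,\infty;(L^1\cap L^\infty)(S_+))$; it is the transport of $\omega_0$ by the measure-preserving flow map of $u$, and is thereby defined for every $t\ge0$. "The solution" refers to it. *)

theory Defs
  imports
    "HOL-Analysis.Analysis"
    "HOL-Library.Real_Mod"
    "HOL-Probability.Essential_Supremum"
begin

text \<open>Each point of the half cylinder is represented by its unique representative in
  \<open>(0, \<infinity>) \<times> [-\<pi>, \<pi>)\<close>; only the values of a function on this set matter.\<close>

definition S_plus :: "(real \<times> real) set" where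
  "S_plus = {x. 0 < fst x \<and> - pi \<le> snd x \<and> snd x < pi}"

abbreviation cyl :: "(real \<times> real) measure" where
  "cyl \<equiv> lebesgue_on S_plus"

text \<open>The covering projection from the plane, which reduces the second coordinate
  modulo \<open>2\<pi>\<close>.\<close>

definition wrap :: "real \<times> real \<Rightarrow> real \<times> real" where
  "wrap x = (fst x, (snd x + pi) rmod (2 * pi) - pi)"

definition Linf_norm :: "(real \<times> real \<Rightarrow> real) \<Rightarrow> ereal" where
  "Linf_norm f = esssup cyl (\<lambda>x. ereal \<bar>f x\<bar>)"

definition in_Linf :: "(real \<times> real \<Rightarrow> real) \<Rightarrow> bool" where
  "in_Linf f \<longleftrightarrow> f \<in> borel_measurable cyl \<and> Linf_norm f < \<infinity>"

text \<open>The support of an element of \<open>L\<^sup>\<infinity>\<close> is its essential support. The images under \<open>wrap\<close>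
  of the balls around a point, intersected with \<open>S_plus\<close>, form a neighbourhood basis of that
  point in the cylinder topology, also on the seam \<open>x\<^sub>2 = -\<pi>\<close>.\<close>

definition supp :: "(real \<times> real \<Rightarrow> real) \<Rightarrow> (real \<times> real) set" where
  "supp f = {x \<in> S_plus. \<forall>e>0. \<not> (AE y in cyl. y \<in> wrap ` ball x e \<longrightarrow> f y = 0)}"

text \<open>The support may touch the wall, so boundedness is all that is required.\<close>

definition compactly_supported :: "(real \<times> real \<Rightarrow> real) \<Rightarrow> bool" where
  "compactly_supported f \<longleftrightarrow> bounded (supp f)"

text \<open>The norm takes values in \<open>[0, \<infinity>]\<close>, so that an upper bound on it includes the
  integrability of \<open>(1 + x\<^sub>1) \<bar>f\<bar>\<close>.\<close>

definition J1_norm :: "(real \<times> real \<Rightarrow> real) \<Rightarrow> ennreal" where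
  "J1_norm f = (\<integral>\<^sup>+ x. ennreal ((1 + fst x) * \<bar>f x\<bar>) \<partial>cyl)"

text \<open>\<open>K_S\<close> and \<open>K\<close> are \<open>2\<pi>\<close>-periodic in the second coordinates. Hence \<open>velocity w\<close> is
  defined on the whole plane, periodic in the second coordinate, and need not be composed with
  \<open>wrap\<close>.\<close>

definition K_S :: "real \<times> real \<Rightarrow> real \<times> real" where
  "K_S x = (sin (snd x) / (4 * pi * (cosh (fst x) - cos (snd x))),
            - sinh (fst x) / (4 * pi * (cosh (fst x) - cos (snd x))))"

definition K :: "real \<times> real \<Rightarrow> real \<times> real \<Rightarrow> real \<times> real" where
  "K x y = K_S (x - y) - K_S (x + (fst y, - snd y))"

definition velocity :: "(real \<times> real \<Rightarrow> real) \<Rightarrow> real \<times> real \<Rightarrow> real \<times> real" where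
  "velocity w x = (\<integral>y. w y *\<^sub>R K x y \<partial>cyl)"

text \<open>Test functions on \<open>[0, \<infinity>)\<close> times the closed half cylinder: restrictions of \<open>C\<^sup>1\<close> functions
  \<open>\<phi>\<close> of \<open>(t, x)\<close> on the whole space that are \<open>2\<pi>\<close>-periodic in \<open>x\<^sub>2\<close> and vanish for large
  \<open>t\<close> or large \<open>x\<^sub>1\<close>. They need not vanish at \<open>t = 0\<close> or on the wall. The functions \<open>\<phi>t\<close> and
  \<open>\<phi>x\<close> are the time derivative and the spatial gradient of \<open>\<phi>\<close>.\<close>

definition test_function ::
  "(real \<times> real \<times> real \<Rightarrow> real) \<Rightarrow> (real \<times> real \<times> real \<Rightarrow> real) \<Rightarrow>
   (real \<times> real \<times> real \<Rightarrow> real \<times> real) \<Rightarrow> bool" where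
  "test_function \<phi> \<phi>t \<phi>x \<longleftrightarrow>
     (\<forall>z. (\<phi> has_derivative (\<lambda>h. fst h * \<phi>t z + snd h \<bullet> \<phi>x z)) (at z)) \<and>
     continuous_on UNIV \<phi>t \<and> continuous_on UNIV \<phi>x \<and>
     (\<forall>t x1 x2. \<phi> (t, x1, x2 + 2 * pi) = \<phi> (t, x1, x2)) \<and>
     (\<exists>R. \<forall>t x. (R < t \<or> R < fst x) \<longrightarrow> \<phi> (t, x) = 0)"

definition weak_solution :: "(real \<times> real \<Rightarrow> real) \<Rightarrow> (real \<Rightarrow> real \<times> real \<Rightarrow> real) \<Rightarrow> bool" where
  "weak_solution \<omega>0 \<omega> \<longleftrightarrow>
     (\<lambda>(t, x). \<omega> t x) \<in> borel_measurable (lebesgue_on ({0..} \<times> S_plus)) \<and>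
     (\<exists>C. \<forall>t\<ge>0. integrable cyl (\<omega> t) \<and> (\<integral>x. \<bar>\<omega> t x\<bar> \<partial>cyl) \<le> C \<and> Linf_norm (\<omega> t) \<le> ereal C) \<and>
     (\<forall>\<phi> \<phi>t \<phi>x. test_function \<phi> \<phi>t \<phi>x \<longrightarrow>
        (\<integral>(t, x). \<omega> t x * (\<phi>t (t, x) + velocity (\<omega> t) x \<bullet> \<phi>x (t, x))
           \<partial>(lebesgue_on ({0..} \<times> S_plus)))
        + (\<integral>x. \<omega>0 x * \<phi> (0, x) \<partial>cyl) = 0)"

text \<open>\<open>X t\<close> is the flow map on the cylinder; \<open>Y\<close> is the lift of the trajectories to the
  universal cover \<open>(0, \<infinity>) \<times> \<real>\<close>, on which the differential equation is stated.\<close>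

definition flow_map ::
  "(real \<Rightarrow> real \<times> real \<Rightarrow> real \<times> real) \<Rightarrow> (real \<Rightarrow> real \<times> real \<Rightarrow> real \<times> real) \<Rightarrow> bool" where
  "flow_map u X \<longleftrightarrow>
     (\<forall>t\<ge>0. bij_betw (X t) S_plus S_plus) \<and>
     (\<exists>Y. \<forall>x\<in>S_plus. Y 0 x = x \<and>
        (\<forall>t\<ge>0. 0 < fst (Y t x) \<and> X t x = wrap (Y t x) \<and>
           ((\<lambda>s. Y s x) has_vector_derivative u t (Y t x)) (at t within {0..})))"

definition measure_preserving_map :: "(real \<times> real \<Rightarrow> real \<times> real) \<Rightarrow> bool" where
  "measure_preserving_map T \<longleftrightarrow> T \<in> cyl \<rightarrow>\<^sub>M cyl \<and> distr cyl cyl T = cyl"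

text \<open>The solution with initial data \<open>\<omega>0\<close>: the Yudovich weak solution, defined at every \<open>t \<ge> 0\<close>
  (as an element of \<open>L\<^sup>\<infinity>\<close>, that is, almost everywhere) as the transport of \<open>\<omega>0\<close> by the
  measure-preserving flow map of its velocity.\<close>

definition euler_solution :: "(real \<times> real \<Rightarrow> real) \<Rightarrow> (real \<Rightarrow> real \<times> real \<Rightarrow> real) \<Rightarrow> bool" where
  "euler_solution \<omega>0 \<omega> \<longleftrightarrow>
     weak_solution \<omega>0 \<omega> \<and>
     (\<exists>X. flow_map (\<lambda>t. velocity (\<omega> t)) X \<and>
        (\<forall>t\<ge>0. measure_preserving_map (X t) \<and> (AE x in cyl. \<omega> t (X t x) = \<omega>0 x)))"

end

theory Submission
  imports Defs
begin

text \<open>The proof is an energy--Casimir argument. The first component of the kernel is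
  antisymmetric, so the impulse \<open>\<integral> x\<^sub>1 \<omega>\<close> is conserved: along the flow it is
  \<open>\<integral> \<omega>\<^sub>0(x) X\<^sub>1(t, x) dx\<close>, whose time derivative is the double integral of an antisymmetric function.
  Integrals \<open>\<integral> A(\<omega>)\<close> are conserved because the flow preserves measure.

  With \<open>A(v) = \<integral> min(\<zeta>(r), v) dr\<close>, the function \<open>v \<mapsto> x\<^sub>1 v - A(v)\<close> is minimal at \<open>v = \<zeta>(x\<^sub>1)\<close>. The
  excess over the minimum, integrated over the cylinder, is conserved and at most
  \<open>(1 + L) \<delta>\<close> at time \<open>0\<close>. On the other hand, for every \<open>\<lambda> > 0\<close> the excess at \<open>v \<le> M\<close> is at least
  \<open>\<lambda> \<bar>v - \<zeta>(x\<^sub>1)\<bar> - \<lambda> (\<zeta>(x\<^sub>1 - \<lambda>) - \<zeta>(x\<^sub>1 + \<lambda>))\<close>, and the error term telescopes to an integral of at most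
  \<open>4\<pi>M\<lambda>\<^sup>2\<close>. Choosing \<open>\<lambda> = \<delta>\<^sup>1\<^sup>/\<^sup>2\<close> bounds the \<open>L\<^sup>1\<close> distance; the part of \<open>\<omega>\<close> above \<open>M\<close> is conserved
  and at most \<open>\<delta>\<close>. The weight \<open>x\<^sub>1\<close> is recovered from the pointwise bound
  \<open>x\<^sub>1 \<bar>\<omega> - \<zeta>\<bar> \<le> 2 L \<bar>\<omega> - \<zeta>\<bar> + x\<^sub>1 (\<omega> - \<zeta>)\<close> and the conservation of the impulse.\<close>

section \<open>Measure and integration on the half cylinder\<close>

lemma S_plus_eq: "S_plus = {0<..} \<times> {-pi..<pi}"
  by (auto simp: S_plus_def)

lemma S_plus_sets [measurable, simp]: "S_plus \<in> sets borel" "S_plus \<in> sets lebesgue"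
proof -
  show "S_plus \<in> sets borel"
    unfolding S_plus_eq borel_prod[symmetric] by measurable
  then show "S_plus \<in> sets lebesgue" by simp
qed

lemma space_cyl [simp]: "space cyl = S_plus"
  by simp

lemma borel_measurable_cylI [measurable (raw)]:
  "f \<in> borel_measurable borel \<Longrightarrow> f \<in> borel_measurable cyl"
  by (auto intro!: measurable_restrict_space1 borel_measurable_if_D simp: measurable_completion)

lemma id_measurable_cyl: "(\<lambda>x. x) \<in> cyl \<rightarrow>\<^sub>M borel"
  by (rule borel_measurable_cylI) simp

lemma fst_measurable_cyl [measurable]: "fst \<in> borel_measurable cyl"
  by (rule borel_measurable_cylI) (simp flip: borel_prod)

lemma snd_measurable_cyl [measurable]: "snd \<in> borel_measurable cyl"
  by (rule borel_measurable_cylI) (simp flip: borel_prod)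

text \<open>Completion leaves the measure of the sets of a countable exhausting family unchanged. As
  \<open>lebesgue\<close> is a completion, this makes Fubini available for double integrals over
  \<open>cyl\<close>.\<close>

lemma sigma_finite_completion:
  assumes "sigma_finite_measure M"
  shows "sigma_finite_measure (completion M)"
proof
  obtain A where A: "countable A" "A \<subseteq> sets M" "\<Union>A = space M" "\<forall>a\<in>A. emeasure M a \<noteq> \<infinity>"
    using sigma_finite_measure.sigma_finite_countable[OF assms] by blast
  then have "\<forall>a\<in>A. emeasure (completion M) a \<noteq> \<infinity>" by auto
  with A show "\<exists>A. countable A \<and> A \<subseteq> sets (completion M) \<and> \<Union>A = space (completion M) \<and>
      (\<forall>a\<in>A. emeasure (completion M) a \<noteq> \<infinity>)"
    by (intro exI[of _ A]) auto
qed

lemma sigma_finite_cyl: "sigma_finite_measure cyl"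
  by (intro sigma_finite_measure_restrict_space sigma_finite_completion
      lborel.sigma_finite_measure_axioms) simp

interpretation cyl: sigma_finite_measure cyl
  by (rule sigma_finite_cyl)

interpretation cyl2: pair_sigma_finite cyl cyl ..

text \<open>For Borel integrands the completion does not change the integral, so the product
  structure of \<open>lborel\<close> on the plane yields an iterated integral.\<close>

lemma nn_integral_cyl:
  assumes [measurable]: "g \<in> borel_measurable borel"
  shows "(\<integral>\<^sup>+ x. g x \<partial>cyl) = (\<integral>\<^sup>+ r. \<integral>\<^sup>+ s. g (r, s) * indicator {0<..} r * indicator {-pi..<pi} s \<partial>lborel \<partial>lborel)"
proof -
  have [measurable]: "g \<in> borel_measurable (lborel \<Otimes>\<^sub>M lborel)" by (simp add: lborel_prod)
  have "(\<integral>\<^sup>+ x. g x \<partial>cyl) = (\<integral>\<^sup>+ x. g x * indicator S_plus x \<partial>lborel)"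
    by (simp add: nn_integral_restrict_space nn_integral_completion)
  also have "\<dots> = (\<integral>\<^sup>+ x. g x * indicator S_plus x \<partial>(lborel \<Otimes>\<^sub>M lborel))"
    by (simp add: lborel_prod)
  also have "\<dots> = (\<integral>\<^sup>+ r. \<integral>\<^sup>+ s. g (r, s) * indicator S_plus (r, s) \<partial>lborel \<partial>lborel)"
    by (subst lborel.nn_integral_fst[symmetric]) (simp_all add: lborel_prod)
  also have "\<dots> = (\<integral>\<^sup>+ r. \<integral>\<^sup>+ s. g (r, s) * indicator {0<..} r * indicator {-pi..<pi} s \<partial>lborel \<partial>lborel)"
    by (intro nn_integral_cong) (auto simp: S_plus_eq indicator_def)
  finally show ?thesis .
qed

lemma nn_integral_cyl_mult:
  assumes [measurable]: "g \<in> borel_measurable borel" "h \<in> borel_measurable borel"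
  shows "(\<integral>\<^sup>+ x. g (fst x) * h (snd x) \<partial>cyl) =
    (\<integral>\<^sup>+ r. g r * indicator {0<..} r \<partial>lborel) * (\<integral>\<^sup>+ s. h s * indicator {-pi..<pi} s \<partial>lborel)"
proof -
  have "(\<integral>\<^sup>+ x. g (fst x) * h (snd x) \<partial>cyl) =
    (\<integral>\<^sup>+ r. \<integral>\<^sup>+ s. (g r * indicator {0<..} r) * (h s * indicator {-pi..<pi} s) \<partial>lborel \<partial>lborel)"
    by (subst nn_integral_cyl) (simp_all add: mult_ac borel_prod[symmetric])
  also have "\<dots> = (\<integral>\<^sup>+ r. g r * indicator {0<..} r \<partial>lborel) * (\<integral>\<^sup>+ s. h s * indicator {-pi..<pi} s \<partial>lborel)"
    by (simp add: nn_integral_cmult nn_integral_multc)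
  finally show ?thesis .
qed

lemma nn_integral_cyl_fst:
  assumes [measurable]: "g \<in> borel_measurable borel"
  shows "(\<integral>\<^sup>+ x. g (fst x) \<partial>cyl) = ennreal (2 * pi) * (\<integral>\<^sup>+ r. g r * indicator {0<..} r \<partial>lborel)"
  using nn_integral_cyl_mult[OF assms, of "\<lambda>_. 1"] by (simp add: mult.commute)

text \<open>A strip of positive width has positive measure, so it cannot consist of exceptional
  points. For a monotone profile, control at some radius in every strip is enough to reach all
  radii.\<close>

lemma AE_cyl_strip:
  assumes "AE x in cyl. P (fst x)" "0 \<le> a" "a < b"
  obtains r where "a < r" "r < b" "P r"
proof -
  have "\<exists>r. a < r \<and> r < b \<and> P r"
  proof (rule ccontr)
    assume "\<not> ?thesis"
    then have *: "AE x in cyl. \<not> (a < fst x \<and> fst x < b)"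
      using assms(1) by (auto elim: eventually_mono)
    have "(\<integral>\<^sup>+ x. indicator {a<..<b} (fst x) \<partial>cyl) = 0"
      by (subst nn_integral_0_iff_AE) (use * in \<open>auto simp: indicator_def elim!: eventually_mono\<close>)
    moreover have "(\<integral>\<^sup>+ x. indicator {a<..<b} (fst x) \<partial>cyl) = ennreal (2 * pi) * (\<integral>\<^sup>+ r. indicator {a<..<b} r \<partial>lborel)"
      using assms by (subst nn_integral_cyl_fst, simp, intro arg_cong[where f="\<lambda>x. _ * x"] nn_integral_cong)
        (auto simp: indicator_def)
    ultimately show False using assms by simp
  qed
  with that show thesis by blast
qed

section \<open>Supports and essential bounds\<close>

lemma wrap_id: "x \<in> S_plus \<Longrightarrow> wrap x = x"
  by (cases x) (auto simp: wrap_def S_plus_def rmod_idem)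

text \<open>The complement of the support is covered by balls on each of which \<open>f\<close>
  vanishes almost everywhere. By Lindelof countably many of them suffice, and countably many null
  sets form a null set.\<close>

lemma AE_supp: "AE x in cyl. f x \<noteq> 0 \<longrightarrow> x \<in> supp f"
proof -
  define V where "V = S_plus - supp f"
  have "\<exists>e>0. AE y in cyl. y \<in> wrap ` ball x e \<longrightarrow> f y = 0" if "x \<in> V" for x
    using that by (auto simp: V_def supp_def)
  then obtain e where e: "\<And>x. x \<in> V \<Longrightarrow> e x > 0" 
      "\<And>x. x \<in> V \<Longrightarrow> AE y in cyl. y \<in> wrap ` ball x (e x) \<longrightarrow> f y = 0" by metis
  obtain F' where F': "F' \<subseteq> (\<lambda>x. ball x (e x)) ` V" "countable F'" "\<Union>F' = \<Union>((\<lambda>x. ball x (e x)) ` V)"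
    using Lindelof[of "(\<lambda>x. ball x (e x)) ` V"] by auto
  have "AE y in cyl. \<forall>B\<in>F'. y \<in> B \<longrightarrow> f y = 0"
  proof (subst AE_ball_countable[OF F'(2)], intro ballI)
    fix B assume "B \<in> F'"
    then obtain x where x: "x \<in> V" "B = ball x (e x)" using F' by auto
    show "AE y in cyl. y \<in> B \<longrightarrow> f y = 0"
      using e(2)[OF x(1)] AE_space 
    proof eventually_elim
      case (elim y)
      \<comment> \<open>A point of the ball that lies in \<open>S_plus\<close> is its own image
        under \<open>wrap\<close>, hence lies in the wrapped ball.\<close>
      then show ?case using x wrap_id[of y] by (metis image_eqI space_cyl)
    qed
  qed
  then show ?thesis using AE_space
  proof eventually_elim
    case (elim y)
    show ?case
    proof (intro impI, rule ccontr)
      assume "f y \<noteq> 0" "y \<notin> supp f"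
      then have "y \<in> V" using elim by (simp add: V_def)
      then have "y \<in> ball y (e y)" using e(1) by simp
      then have "y \<in> \<Union>F'" using F'(3) \<open>y \<in> V\<close> by blast
      then show False using elim \<open>f y \<noteq> 0\<close> by auto
    qed
  qed
qed

lemma AE_le_Linf_norm:
  assumes "Linf_norm f \<le> ereal C" 
  shows "AE x in cyl. \<bar>f x\<bar> \<le> C"
  using esssup_AE[of "\<lambda>x. ereal \<bar>f x\<bar>" cyl] 
  by eventually_elim (use assms in \<open>metis Linf_norm_def ereal_less_eq(3) order_trans\<close>)

section \<open>The Biot--Savart kernel\<close>

text \<open>The difference has derivative cos v - 1/2, which is nonnegative on [0, 1] because 1 < pi
  / 3.\<close>

lemma sin_ge_half:
  fixes u :: real
  assumes "0 \<le> u" "u \<le> 1"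
  shows "u / 2 \<le> sin u"
proof -
  have "sin 0 - 0 / 2 \<le> sin u - u / 2"
  proof (rule DERIV_nonneg_imp_nondecreasing[OF assms(1)])
    fix v :: real assume v: "0 \<le> v" "v \<le> u"
    have "cos (pi / 3) \<le> cos v"
      using v assms pi_gt3 by (intro cos_monotone_0_pi_le) auto
    then have "0 \<le> cos v - 1 / 2" by (simp add: cos_60)
    moreover have "((\<lambda>v. sin v - v / 2) has_real_derivative cos v - 1 / 2) (at v)"
      by (auto intro!: derivative_eq_intros)
    ultimately show "\<exists>y. ((\<lambda>v. sin v - v / 2) has_real_derivative y) (at v) \<and> 0 \<le> y" by blast
  qed
  then show ?thesis by simp
qed

text \<open>Up to the angle 2, the half-angle formula reduces this to \<open>sin_ge_half\<close>.
  Beyond 2 the cosine is negative, while the left-hand side is at most 1 since pi < 4.\<close>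

lemma one_minus_cos_ge:
  fixes s :: real
  assumes "\<bar>s\<bar> \<le> pi"
  shows "s\<^sup>2 / 16 \<le> 1 - cos s"
proof -
  have *: "t\<^sup>2 / 16 \<le> 1 - cos t" if t: "0 \<le> t" "t \<le> pi" for t :: real
  proof (cases "t \<le> 2")
    case True
    have "t / 4 \<le> sin (t / 2)" using sin_ge_half[of "t/2"] t True by simp
    then have "(t/4)\<^sup>2 \<le> (sin (t/2))\<^sup>2" using t by (intro power_mono) auto
    then have "t\<^sup>2 / 16 \<le> (sin (t/2))\<^sup>2" by (simp add: power_divide)
    moreover have "cos t = 1 - 2 * (sin (t/2))\<^sup>2" using cos_double_sin[of "t/2"] by simp
    moreover have "0 \<le> (sin (t/2))\<^sup>2" by simp
    ultimately show ?thesis by linarith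
  next
    case False
    have "cos t \<le> cos 2" using False t by (intro cos_monotone_0_pi_le) auto
    then have "1 \<le> 1 - cos t" using cos_two_less_zero by linarith
    moreover have "t\<^sup>2 \<le> 4\<^sup>2" using t pi_less_4 by (intro power_mono) linarith+
    ultimately show ?thesis by simp
  qed
  show ?thesis using *[of "\<bar>s\<bar>"] assms by simp
qed

lemma le_sinh:
  fixes r :: real
  assumes "0 \<le> r"
  shows "r \<le> sinh r"
proof -
  have "sinh 0 - 0 \<le> sinh r - r"
  proof (rule DERIV_nonneg_imp_nondecreasing[OF assms])
    fix v :: real
    have "((\<lambda>v. sinh v - v) has_real_derivative cosh v - 1) (at v)"
      by (auto intro!: derivative_eq_intros)
    then show "\<exists>y. ((\<lambda>v. sinh v - v) has_real_derivative y) (at v) \<and> 0 \<le> y" 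
      using cosh_real_ge_1[of v] by (intro exI[of _ "cosh v - 1"]) simp
  qed
  then show ?thesis by simp
qed

text \<open>The half-argument formula turns cosh r - 1 into twice the square of sinh (r / 2), to
  which \<open>le_sinh\<close> applies.\<close>

lemma cosh_minus_one_ge: "(r::real)\<^sup>2 / 2 \<le> cosh r - 1"
proof -
  have "\<bar>r\<bar> / 2 \<le> sinh (\<bar>r\<bar> / 2)" by (rule le_sinh) simp
  then have "(\<bar>r\<bar>/2)\<^sup>2 \<le> (sinh (\<bar>r\<bar>/2))\<^sup>2" by (intro power_mono) auto
  moreover have "cosh \<bar>r\<bar> = 2 * (sinh (\<bar>r\<bar>/2))\<^sup>2 + 1"
    using cosh_double_cosh[of "\<bar>r\<bar>/2"] cosh_square_eq[of "\<bar>r\<bar>/2"] by simp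
  ultimately show ?thesis by (simp add: power_divide)
qed

text \<open>In \<open>ennreal\<close> the inverse of \<open>0\<close> is \<open>\<infinity>\<close>, so the kernel bounds below hold trivially on the
  singular set, where the real kernel takes the junk value of a division by \<open>0\<close>.\<close>

definition isqrt :: "real \<Rightarrow> ennreal" where
  "isqrt r = inverse (ennreal (sqrt \<bar>r\<bar>))"

lemma isqrt_measurable [measurable]: "isqrt \<in> borel_measurable borel"
  unfolding isqrt_def by measurable

lemma isqrt_minus [simp]: "isqrt (- r) = isqrt r"
  by (simp add: isqrt_def)

lemma isqrt_eq: "r \<noteq> 0 \<Longrightarrow> isqrt r = ennreal (1 / sqrt \<bar>r\<bar>)"
  by (simp add: isqrt_def inverse_ennreal inverse_eq_divide)

lemma isqrt_antimono: 
  assumes "\<bar>r\<bar> \<le> \<bar>s\<bar>"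
  shows "isqrt s \<le> isqrt r"
proof (cases "r = 0")
  case True
  then show ?thesis by (simp add: isqrt_def)
next
  case False
  then have "1 / sqrt \<bar>s\<bar> \<le> 1 / sqrt \<bar>r\<bar>"
    using assms by (intro divide_left_mono) auto
  then show ?thesis using False assms by (auto simp: isqrt_eq intro!: ennreal_leI)
qed

lemma nn_integral_isqrt_finite: 
  "(\<integral>\<^sup>+ r. isqrt r * indicator {-R..R} r \<partial>lborel) < \<infinity>"
proof -
  define J where "J = (\<integral>\<^sup>+ r. isqrt r * indicator {0..\<bar>R\<bar>} r \<partial>lborel)"
  have "J = (\<integral>\<^sup>+ r. indicator {0..\<bar>R\<bar>} r * ennreal (r powr (-1/2)) \<partial>lborel)"
    unfolding J_def
  proof (intro nn_integral_cong_AE)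
    \<comment> \<open>The two integrands differ at 0, where \<open>isqrt\<close> is infinite and
      \<open>powr\<close> gives 0; a single point is negligible.\<close>
    show "AE r in lborel. isqrt r * indicator {0..\<bar>R\<bar>} r = indicator {0..\<bar>R\<bar>} r * ennreal (r powr (-1/2))"
      using AE_lborel_singleton[of "0::real"]
      by eventually_elim (auto simp: indicator_def isqrt_eq powr_minus powr_half_sqrt inverse_eq_divide)
  qed
  also have "\<dots> = (\<integral>\<^sup>+ r. ennreal (indicator {0..\<bar>R\<bar>} r * (r powr (-1/2))) \<partial>lborel)"
    by (intro nn_integral_cong) (auto simp: indicator_def)
  also have "\<dots> = ennreal (\<bar>R\<bar> powr (-1/2 + 1) / (-1/2+1))"
    by (rule nn_integral_has_integral_lebesgue[OF _ has_integral_powr_from_0]) auto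
  finally have J: "J < \<infinity>" by simp
  have "(\<integral>\<^sup>+ r. isqrt r * indicator {-R..R} r \<partial>lborel) \<le>
     (\<integral>\<^sup>+ r. isqrt r * indicator {0..\<bar>R\<bar>} r + isqrt r * indicator {0..\<bar>R\<bar>} (-r) \<partial>lborel)"
    by (intro nn_integral_mono) (auto simp: indicator_def)
  also have "\<dots> = J + (\<integral>\<^sup>+ r. isqrt r * indicator {0..\<bar>R\<bar>} (-r) \<partial>lborel)"
    by (subst nn_integral_add) (auto simp: J_def)
  also have "(\<integral>\<^sup>+ r. isqrt r * indicator {0..\<bar>R\<bar>} (-r) \<partial>lborel) = J"
    using nn_integral_real_affine[of "\<lambda>r. isqrt r * indicator {0..\<bar>R\<bar>} (-r)" "-1" 0] by (simp add: J_def)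
  finally show ?thesis using J by (simp add: le_less_trans)
qed

lemma nn_integral_reflect:
  fixes f :: "real \<Rightarrow> ennreal"
  assumes [measurable]: "f \<in> borel_measurable borel"
  shows "(\<integral>\<^sup>+ s. f (c - s) \<partial>lborel) = (\<integral>\<^sup>+ s. f s \<partial>lborel)"
  using nn_integral_real_affine[of f "-1" c] by simp

text \<open>A difference of two angles, in \<open>(-2\<pi>, 2\<pi>)\<close>, is within \<open>\<pi>\<close> of \<open>0\<close>, \<open>2\<pi>\<close> or \<open>-2\<pi>\<close>; \<open>pker\<close>
  has a singularity at each of them. Bounding the planar singularity by the product
  \<open>qker r * pker s\<close> reduces its integrability to that of \<open>1 / sqrt\<close> in one variable.\<close>

definition qker :: "real \<Rightarrow> ennreal" where
  "qker r = isqrt r * indicator {-1..1} r"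

definition pker :: "real \<Rightarrow> ennreal" where
  "pker s = isqrt s + isqrt (s - 2 * pi) + isqrt (s + 2 * pi)"

lemma qker_measurable [measurable]: "qker \<in> borel_measurable borel"
  and pker_measurable [measurable]: "pker \<in> borel_measurable borel"
  unfolding qker_def pker_def by measurable

lemma cosh_minus_cos_pos: "0 \<le> cosh r - cos (s::real)"
  using cosh_real_ge_1[of r] cos_le_one[of s] by linarith

text \<open>For large \<open>r\<close> the denominator is bounded away from 0. Otherwise it
  dominates a quadratic form in \<open>r\<close> and the angle reduced to [-pi, pi], hence their
  product, whose inverse square root separates the two variables.\<close>

lemma isqrt_denominator_le:
  assumes "\<bar>s\<bar> < 2 * pi"
  shows "isqrt (cosh r - cos s) \<le> 2 + 2 * (qker r * pker s)"
proof -
  define d where "d = cosh r - cos s"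
  show ?thesis
  proof (cases "\<bar>r\<bar> \<le> 1")
    case False
    have "1 \<le> r\<^sup>2" using False one_le_power[of "\<bar>r\<bar>" 2] by simp
    \<comment> \<open>The available bound 1/2 is weakened to 1/4, whose square root is rational;
      this produces the summand 2 of the claim.\<close>
    then have "1/4 \<le> d" using cosh_minus_one_ge[of r] cos_le_one[of s] unfolding d_def by linarith
    then have "isqrt d \<le> isqrt (1/4)" by (intro isqrt_antimono) auto
    also have "\<dots> = 2" by (simp add: isqrt_eq real_sqrt_divide)
    also have "(2::ennreal) + 0 \<le> 2 + 2 * (qker r * pker s)" by (intro add_left_mono) simp
    finally show ?thesis by (simp add: d_def)
  next
    case True
    have *: "isqrt d \<le> 2 * (isqrt r * isqrt w)" if w: "cos w = cos s" "\<bar>w\<bar> \<le> pi" for w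
    proof (cases "r = 0 \<or> w = 0")
      case True
      then show ?thesis by (auto simp: isqrt_def ennreal_mult_eq_top_iff ennreal_top_mult ennreal_mult_top)
    next
      case False
      have "r\<^sup>2 / 2 + w\<^sup>2 / 16 \<le> d" 
        using cosh_minus_one_ge[of r] one_minus_cos_ge[of w] w unfolding d_def by linarith
      \<comment> \<open>Nonnegativity of this square is the arithmetic-geometric mean inequality
        that extracts the product from the two squares.\<close>
      moreover have "(\<bar>r\<bar> - \<bar>w\<bar> / 4)\<^sup>2 = r\<^sup>2 - \<bar>r\<bar> * \<bar>w\<bar> / 2 + w\<^sup>2 / 16"
        by (simp add: power2_diff power_divide)
      moreover have "0 \<le> (\<bar>r\<bar> - \<bar>w\<bar> / 4)\<^sup>2" "0 \<le> w\<^sup>2" by simp_all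
      ultimately have d: "\<bar>r\<bar> * \<bar>w\<bar> / 4 \<le> d" by linarith
      have "isqrt d \<le> isqrt (\<bar>r\<bar> * \<bar>w\<bar> / 4)" using d by (intro isqrt_antimono) auto
      also have "\<dots> = ennreal (2 * (1 / sqrt \<bar>r\<bar> * (1 / sqrt \<bar>w\<bar>)))"
        using False by (subst isqrt_eq) (auto simp: real_sqrt_divide real_sqrt_mult)
      also have "\<dots> = 2 * (isqrt r * isqrt w)"
      proof -
        have "ennreal (2 * (a * b)) = 2 * (ennreal a * ennreal b)" if "0 \<le> a" "0 \<le> b" for a b
          using that by (simp add: ennreal_mult)
        from this[of "1 / sqrt \<bar>r\<bar>" "1 / sqrt \<bar>w\<bar>"] show ?thesis
          using False by (simp add: isqrt_eq)
      qed
      finally show ?thesis .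
    qed
    obtain w where w: "cos w = cos s" "\<bar>w\<bar> \<le> pi" "w = s \<or> w = s - 2 * pi \<or> w = s + 2 * pi"
    proof -
      consider "\<bar>s\<bar> \<le> pi" | "s > pi" | "s < - pi" by linarith
      then show thesis
      proof cases
        case 1
        then show thesis by (intro that[of s]) auto
      next
        case 2
        have "cos (s - 2 * pi) = cos s" using cos_periodic[of "s - 2 * pi"] by simp
        with 2 assms show thesis by (intro that[of "s - 2 * pi"]) auto
      next
        case 3
        with assms show thesis by (intro that[of "s + 2 * pi"]) auto
      qed
    qed
    have "isqrt w \<le> pker s"
    proof -
      have "x \<le> x + y" for x y :: ennreal by (rule add_increasing2) auto
      then have "x \<le> x + y + z" "y \<le> x + y + z" "z \<le> x + y + z" for x y z :: ennreal
        by (metis add.assoc add.commute)+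
      then show ?thesis using w(3) unfolding pker_def by blast
    qed
    then have "2 * (isqrt r * isqrt w) \<le> 2 * (isqrt r * pker s)"
      by (intro mult_left_mono) auto
    also have "\<dots> = 2 * (qker r * pker s)" using True by (simp add: qker_def indicator_def abs_le_iff)
    also have "\<dots> \<le> 2 + 2 * (qker r * pker s)" by simp
    finally show ?thesis using order_trans[OF *[OF w(1,2)]] by (simp add: d_def)
  qed
qed

text \<open>If q is the square root of the denominator cosh r - cos s, the numerators are at most 2
  q and q^2 + 2 q in absolute value. Division by a multiple of q^2 leaves a singularity of order 1 /
  q and a bounded remainder.\<close>

lemma norm_K_S_le: "ennreal (norm (K_S (r, s))) \<le> 1 + isqrt (cosh r - cos s)"
proof -
  define a where "a = cosh r - 1"
  define b where "b = 1 - cos s"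
  have ab: "0 \<le> a" "0 \<le> b" using cosh_real_ge_1[of r] by (simp_all add: a_def b_def)
  show ?thesis
  proof (cases "a + b = 0")
    case True
    then have D: "cosh r - cos s = 0" unfolding a_def b_def by linarith
    have "K_S (r, s) = 0" unfolding K_S_def fst_conv snd_conv D by (simp add: zero_prod_def)
    then show ?thesis by simp
  next
    case False
    then have d: "0 < a + b" using ab by linarith
    define q where "q = sqrt (a + b)"
    have q: "q > 0" "a + b = q\<^sup>2" using d by (simp_all add: q_def)
    have "(sin s)\<^sup>2 \<le> 2 * b" 
    proof -
      have "(sin s)\<^sup>2 = b * (1 + cos s)"
        unfolding sin_squared_eq b_def by (simp add: power2_eq_square algebra_simps)
      also have "\<dots> \<le> b * 2" using ab by (intro mult_left_mono) auto
      finally show ?thesis by simp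
    qed
    then have "(sin s)\<^sup>2 \<le> (2 * q)\<^sup>2" using q ab by (simp add: power_mult_distrib)
    then have "\<bar>sin s\<bar>\<^sup>2 \<le> (2 * q)\<^sup>2" by simp
    then have s: "\<bar>sin s\<bar> \<le> 2 * q" by (rule power2_le_imp_le) (use q in auto)
    have "(sinh r)\<^sup>2 = a * a + 2 * a"
      unfolding a_def using sinh_square_eq[of r] by (simp add: power2_eq_square algebra_simps)
    also have "\<dots> \<le> (a + 2 * q)\<^sup>2"
    proof -
      have "(a + 2 * q)\<^sup>2 = a * a + 4 * q\<^sup>2 + 4 * (a * q)" by algebra
      then show ?thesis using q ab mult_nonneg_nonneg[of a q] by linarith
    qed
    finally have "\<bar>sinh r\<bar>\<^sup>2 \<le> (a + 2 * q)\<^sup>2" by simp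
    then have "\<bar>sinh r\<bar> \<le> a + 2 * q" by (rule power2_le_imp_le) (use q ab in auto)
    then have h: "\<bar>sinh r\<bar> \<le> q\<^sup>2 + 2 * q" using q ab by linarith
    have D: "cosh r - cos s = q\<^sup>2" using q by (simp add: a_def b_def)
    have "norm (K_S (r, s)) \<le> \<bar>fst (K_S (r, s))\<bar> + \<bar>snd (K_S (r, s))\<bar>"
      using norm_Pair_le[of "fst (K_S (r, s))" "snd (K_S (r, s))"] by simp
    also have "\<dots> = (\<bar>sin s\<bar> + \<bar>sinh r\<bar>) / (4 * pi * q\<^sup>2)"
      unfolding K_S_def fst_conv snd_conv D by (simp add: abs_mult add_divide_distrib)
    also have "\<dots> \<le> (4 * q + q\<^sup>2) / (4 * q\<^sup>2)"
    proof (rule frac_le)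
      have "1 * q\<^sup>2 \<le> pi * q\<^sup>2" using pi_gt3 by (intro mult_right_mono) auto
      then show "4 * q\<^sup>2 \<le> 4 * pi * q\<^sup>2" by simp
      show "\<bar>sin s\<bar> + \<bar>sinh r\<bar> \<le> 4 * q + q\<^sup>2" using s h by linarith
    qed (use q in auto)
    also have "\<dots> = 1 / q + 1 / 4" using q(1) by (simp add: add_divide_distrib power2_eq_square)
    also have "\<dots> \<le> 1 + 1 / q" by simp
    finally have "ennreal (norm (K_S (r, s))) \<le> ennreal (1 + 1 / q)" by (rule ennreal_leI)
    also have "\<dots> = 1 + ennreal (1 / q)" using q(1) by (subst ennreal_plus) auto
    also have "\<dots> = 1 + isqrt (cosh r - cos s)" using q(1) unfolding D by (subst isqrt_eq) auto
    finally show ?thesis .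
  qed
qed

text \<open>The image term has the same angle difference, and |x1 - y1| \<le> x1 + y1 in the half
  cylinder makes its denominator the larger one. Hence the bound for the direct term also covers the
  image term.\<close>

lemma norm_K_le:
  assumes "x \<in> S_plus" "y \<in> S_plus"
  shows "ennreal (norm (K x y)) \<le> 6 + 4 * (qker (fst x - fst y) * pker (snd x - snd y))"
proof -
  define r where "r = fst x - fst y"
  define s where "s = snd x - snd y"
  have s: "\<bar>s\<bar> < 2 * pi" using assms by (auto simp: s_def S_plus_def)
  have "cosh r \<le> cosh (fst x + fst y)"
    using assms cosh_real_nonneg_le_iff[of "\<bar>r\<bar>" "fst x + fst y"] by (auto simp: r_def S_plus_def)
  then have *: "isqrt (cosh (fst x + fst y) - cos s) \<le> isqrt (cosh r - cos s)"
    using cosh_minus_cos_pos[of r s] by (intro isqrt_antimono) auto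
  have "norm (K x y) \<le> norm (K_S (r, s)) + norm (K_S (fst x + fst y, s))"
    using norm_triangle_ineq4[of "K_S (x - y)" "K_S (x + (fst y, - snd y))"]
    by (simp add: K_def r_def s_def minus_prod_def plus_prod_def)
  then have "ennreal (norm (K x y)) \<le> ennreal (norm (K_S (r, s))) + ennreal (norm (K_S (fst x + fst y, s)))"
    by (subst ennreal_plus[symmetric]) (auto intro: ennreal_leI simp del: ennreal_plus)
  also have "\<dots> \<le> (1 + isqrt (cosh r - cos s)) + (1 + isqrt (cosh r - cos s))"
    using norm_K_S_le[of r s] order_trans[OF norm_K_S_le add_left_mono[OF *]] by (intro add_mono)
  also have "\<dots> = 2 + 2 * isqrt (cosh r - cos s)"
    by (simp add: mult_2 algebra_simps flip: one_add_one)
  also have "\<dots> \<le> 2 + 2 * (2 + 2 * (qker r * pker s))"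
    using isqrt_denominator_le[OF s] by (intro add_left_mono mult_left_mono) auto
  also have "\<dots> = 6 + 4 * (qker r * pker s)"
    by (simp add: algebra_simps)
  finally show ?thesis by (simp add: r_def s_def)
qed

section \<open>Measurability and antisymmetry of the kernel\<close>

lemma K_S_measurable [measurable]: "K_S \<in> borel_measurable borel"
proof -
  have "continuous_on UNIV (\<lambda>x::real \<times> real. sin (snd x))"
    "continuous_on UNIV (\<lambda>x::real \<times> real. - sinh (fst x))"
    "continuous_on UNIV (\<lambda>x::real \<times> real. 4 * pi * (cosh (fst x) - cos (snd x)))"
    by (intro continuous_intros)+
  then show ?thesis
    unfolding K_S_def
    by (intro borel_measurable_Pair borel_measurable_divide borel_measurable_continuous_onI)
qed

lemma K_measurable: "(\<lambda>z. K (fst z) (snd z)) \<in> borel_measurable (cyl \<Otimes>\<^sub>M cyl)"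
proof -
  have [measurable]: "(\<lambda>z. fst z) \<in> borel_measurable (cyl \<Otimes>\<^sub>M cyl)"
    "(\<lambda>z. snd z) \<in> borel_measurable (cyl \<Otimes>\<^sub>M cyl)"
    using measurable_compose[OF measurable_fst id_measurable_cyl]
      measurable_compose[OF measurable_snd id_measurable_cyl] by auto
  have "(\<lambda>y. (fst y, - snd y)) \<in> borel_measurable (borel :: (real \<times> real) measure)"
    by (intro borel_measurable_continuous_onI continuous_intros)
  from measurable_compose[OF _ this]
  have [measurable]: "(\<lambda>z. (fst (snd z), - snd (snd z))) \<in> borel_measurable (cyl \<Otimes>\<^sub>M cyl)"
    by simp
  show ?thesis
    unfolding K_def by measurable
qed

text \<open>Exchanging the points reverses the sign of the angle difference and leaves both
  denominators unchanged. This cancels the self-interaction in the impulse.\<close>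

lemma fst_K_antisym: "fst (K y x) = - fst (K x y)"
proof -
  have "cosh (fst y - fst x) = cosh (fst x - fst y)" "cos (snd y - snd x) = cos (snd x - snd y)"
    "sin (snd y - snd x) = - sin (snd x - snd y)"
    using cosh_minus[of "fst x - fst y"] cos_minus[of "snd x - snd y"] sin_minus[of "snd x - snd y"] by simp_all
  then show ?thesis by (simp add: K_def K_S_def add.commute)
qed

section \<open>The velocity field\<close>

text \<open>The dominating kernel factors, so its integral is a product of two one-dimensional
  integrals, each bounded independently of \<open>x\<close> after a reflection and
  translation.\<close>

lemma nn_integral_kernel_bound:
  obtains B :: real where "0 \<le> B" "\<And>x. x \<in> S_plus \<Longrightarrow>
    (\<integral>\<^sup>+ y. qker (fst x - fst y) * pker (snd x - snd y) \<partial>cyl) \<le> ennreal B"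
proof -
  define P where "P = (\<integral>\<^sup>+ s. isqrt s * indicator {- (4 * pi)..4 * pi} s \<partial>lborel)"
  define Q where "Q = (\<integral>\<^sup>+ r. qker r \<partial>lborel)"
  have fin: "P < \<infinity>" "Q < \<infinity>"
    unfolding P_def Q_def qker_def by (rule nn_integral_isqrt_finite)+
  have le: "(\<integral>\<^sup>+ y. qker (fst x - fst y) * pker (snd x - snd y) \<partial>cyl) \<le> Q * (P + P + P)"
    if x: "x \<in> S_plus" for x
  proof -
    \<comment> \<open>The three singularities of \<open>pker\<close> are centred at
      \<open>snd x\<close> and \<open>snd x\<close> shifted by 2 pi either way, so |c| \<le> 3 pi.
      With |s| \<le> pi, the difference stays within 4 pi, the range used in
      \<open>P\<close>.\<close>
    have *: "(\<integral>\<^sup>+ s. isqrt (c - s) * indicator {-pi..<pi} s \<partial>lborel) \<le> P" if "\<bar>c\<bar> \<le> 3 * pi" for c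
    proof -
      have "(\<integral>\<^sup>+ s. isqrt (c - s) * indicator {-pi..<pi} s \<partial>lborel) \<le>
          (\<integral>\<^sup>+ s. isqrt (c - s) * indicator {- (4 * pi)..4 * pi} (c - s) \<partial>lborel)"
        using that by (intro nn_integral_mono mult_left_mono) (auto simp: indicator_def abs_le_iff)
      also have "\<dots> = P" unfolding P_def by (rule nn_integral_reflect) measurable
      finally show ?thesis .
    qed
    have "(\<integral>\<^sup>+ y. qker (fst x - fst y) * pker (snd x - snd y) \<partial>cyl) =
       (\<integral>\<^sup>+ r. qker (fst x - r) * indicator {0<..} r \<partial>lborel) *
       (\<integral>\<^sup>+ s. pker (snd x - s) * indicator {-pi..<pi} s \<partial>lborel)"
      by (rule nn_integral_cyl_mult) measurable
    also have "\<dots> \<le> Q * (P + P + P)"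
    proof (rule mult_mono)
      have "(\<integral>\<^sup>+ r. qker (fst x - r) * indicator {0<..} r \<partial>lborel) \<le> (\<integral>\<^sup>+ r. qker (fst x - r) \<partial>lborel)"
        by (intro nn_integral_mono) (auto simp: indicator_def)
      also have "\<dots> = Q" unfolding Q_def by (rule nn_integral_reflect) measurable
      finally show "(\<integral>\<^sup>+ r. qker (fst x - r) * indicator {0<..} r \<partial>lborel) \<le> Q" .
      have "(\<integral>\<^sup>+ s. pker (snd x - s) * indicator {-pi..<pi} s \<partial>lborel) =
         (\<integral>\<^sup>+ s. isqrt (snd x - s) * indicator {-pi..<pi} s \<partial>lborel) +
         (\<integral>\<^sup>+ s. isqrt ((snd x - 2 * pi) - s) * indicator {-pi..<pi} s \<partial>lborel) +
         (\<integral>\<^sup>+ s. isqrt ((snd x + 2 * pi) - s) * indicator {-pi..<pi} s \<partial>lborel)"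
        unfolding pker_def
        by (simp add: nn_integral_add[symmetric] distrib_right algebra_simps)
      also have "\<dots> \<le> P + P + P"
        using x by (intro add_mono *) (auto simp: S_plus_def)
      finally show "(\<integral>\<^sup>+ s. pker (snd x - s) * indicator {-pi..<pi} s \<partial>lborel) \<le> P + P + P" .
    qed auto
    finally show ?thesis .
  qed
  have "Q * (P + P + P) < \<infinity>" using fin by (simp add: ennreal_mult_less_top)
  then have "Q * (P + P + P) = ennreal (enn2real (Q * (P + P + P)))" by simp
  with le show thesis by (intro that[of "enn2real (Q * (P + P + P))"]) auto
qed

lemma K_section_measurable:
  assumes "x \<in> S_plus"
  shows "K x \<in> borel_measurable cyl"
proof -
  have "Pair x \<in> cyl \<rightarrow>\<^sub>M cyl \<Otimes>\<^sub>M cyl" using assms by (intro measurable_Pair1') simp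
  from measurable_compose[OF this K_measurable] show ?thesis by simp
qed

text \<open>The constant part of the kernel bound is paired with the integral of |w|, the singular
  part with the essential bound of |w|. The resulting \<open>A\<close> depends only on
  \<open>C\<close>, which makes the velocity bound uniform in time.\<close>

lemma nn_integral_K_bound:
  obtains A :: real where "0 \<le> A" 
    "\<And>w x. w \<in> borel_measurable cyl \<Longrightarrow> AE y in cyl. \<bar>w y\<bar> \<le> C \<Longrightarrow>
      (\<integral>\<^sup>+ y. ennreal \<bar>w y\<bar> \<partial>cyl) \<le> ennreal C \<Longrightarrow> x \<in> S_plus \<Longrightarrow>
      (\<integral>\<^sup>+ y. ennreal (norm (w y *\<^sub>R K x y)) \<partial>cyl) \<le> ennreal A"
proof -
  obtain B where B: "0 \<le> B" "\<And>x. x \<in> S_plus \<Longrightarrow>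
    (\<integral>\<^sup>+ y. qker (fst x - fst y) * pker (snd x - snd y) \<partial>cyl) \<le> ennreal B"
    using nn_integral_kernel_bound by blast
  have "(\<integral>\<^sup>+ y. ennreal (norm (w y *\<^sub>R K x y)) \<partial>cyl) \<le> ennreal (6 * \<bar>C\<bar> + \<bar>C\<bar> * 4 * B)"
    if w[measurable]: "w \<in> borel_measurable cyl" and C: "AE y in cyl. \<bar>w y\<bar> \<le> C"
      "(\<integral>\<^sup>+ y. ennreal \<bar>w y\<bar> \<partial>cyl) \<le> ennreal C" and x: "x \<in> S_plus" for w x
  proof -
    let ?q = "\<lambda>y. qker (fst x - fst y) * pker (snd x - snd y)"
    have "(\<integral>\<^sup>+ y. ennreal (norm (w y *\<^sub>R K x y)) \<partial>cyl) \<le>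
      (\<integral>\<^sup>+ y. 6 * ennreal \<bar>w y\<bar> + ennreal (\<bar>C\<bar> * 4) * ?q y \<partial>cyl)"
    proof (rule nn_integral_mono_AE)
      show "AE y in cyl. ennreal (norm (w y *\<^sub>R K x y)) \<le> 6 * ennreal \<bar>w y\<bar> + ennreal (\<bar>C\<bar> * 4) * ?q y"
        using C(1) AE_space
      proof eventually_elim
        case (elim y)
        have "ennreal (norm (w y *\<^sub>R K x y)) = ennreal \<bar>w y\<bar> * ennreal (norm (K x y))"
          by (simp add: ennreal_mult)
        also have "\<dots> \<le> ennreal \<bar>w y\<bar> * (6 + 4 * ?q y)"
          using norm_K_le[OF x, of y] elim by (intro mult_left_mono) auto
        also have "\<dots> = 6 * ennreal \<bar>w y\<bar> + ennreal \<bar>w y\<bar> * (4 * ?q y)"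
          by (simp add: distrib_left mult.commute)
        also have "\<dots> \<le> 6 * ennreal \<bar>w y\<bar> + ennreal \<bar>C\<bar> * (4 * ?q y)"
          using elim by (intro add_left_mono mult_right_mono ennreal_leI) auto
        also have "\<dots> = 6 * ennreal \<bar>w y\<bar> + ennreal (\<bar>C\<bar> * 4) * ?q y"
          by (simp add: ennreal_mult mult.assoc)
        finally show ?case .
      qed
    qed
    also have "\<dots> = 6 * (\<integral>\<^sup>+ y. ennreal \<bar>w y\<bar> \<partial>cyl) + ennreal (\<bar>C\<bar> * 4) * (\<integral>\<^sup>+ y. ?q y \<partial>cyl)"
      by (simp add: nn_integral_add nn_integral_cmult)
    also have "\<dots> \<le> 6 * ennreal \<bar>C\<bar> + ennreal (\<bar>C\<bar> * 4) * ennreal B"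
      using B(2)[OF x] C(2) by (intro add_mono mult_left_mono order_trans[OF C(2)] ennreal_leI) auto
    also have "\<dots> = ennreal (6 * \<bar>C\<bar> + \<bar>C\<bar> * 4 * B)"
      using B(1) by (simp add: ennreal_mult)
    finally show ?thesis .
  qed
  with B(1) show thesis by (intro that[of "6 * \<bar>C\<bar> + \<bar>C\<bar> * 4 * B"]) auto
qed

text \<open>\<open>wrap\<close> changes the angle by a multiple of 2 pi, a period of the kernel. The
  velocity along the lifted trajectory is therefore the velocity along the trajectory on the
  cylinder.\<close>

lemma velocity_wrap: "velocity w (wrap x) = velocity w x"
proof -
  obtain n :: int where n: "snd (wrap x) = snd x + 2 * pi * n"
  proof (rule that[of "- \<lfloor>(snd x + pi) / (2 * pi)\<rfloor>"])
    show "snd (wrap x) = snd x + 2 * pi * real_of_int (- \<lfloor>(snd x + pi) / (2 * pi)\<rfloor>)"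
      by (simp add: wrap_def rmod_def)
  qed
  have "K (wrap x) y = K x y" for y
  proof -
    have "sin (snd (wrap x) - snd y) = sin (snd x - snd y) \<and> cos (snd (wrap x) - snd y) = cos (snd x - snd y)"
      by (subst sin_cos_eq_iff) (auto simp: n)
    moreover have "fst (wrap x) = fst x" by (simp add: wrap_def)
    ultimately show ?thesis by (simp add: K_def K_S_def)
  qed
  then show ?thesis by (simp add: velocity_def)
qed

text \<open>A single time slice of the vorticity; every slice of a solution is an instance, with the
  same \<open>A\<close> for all times.\<close>

locale bounded_vorticity =
  fixes w :: "real \<times> real \<Rightarrow> real" and A :: real
  assumes w_integrable: "integrable cyl w"
    and K_bound: "\<And>x. x \<in> S_plus \<Longrightarrow> (\<integral>\<^sup>+ y. ennreal (norm (w y *\<^sub>R K x y)) \<partial>cyl) \<le> ennreal A"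
    and A_nonneg: "0 \<le> A"
begin

lemma w_meas [measurable]: "w \<in> borel_measurable cyl"
  using w_integrable by simp

lemma integrable_K:
  assumes "x \<in> S_plus"
  shows "integrable cyl (\<lambda>y. w y *\<^sub>R K x y)"
proof (rule integrableI_bounded)
  show "(\<lambda>y. w y *\<^sub>R K x y) \<in> borel_measurable cyl"
    using K_section_measurable[OF assms] by measurable
  show "(\<integral>\<^sup>+ y. ennreal (norm (w y *\<^sub>R K x y)) \<partial>cyl) < \<infinity>"
    using K_bound[OF assms] by (simp add: le_less_trans)
qed

lemma fst_velocity:
  assumes "x \<in> S_plus"
  shows "fst (velocity w x) = (\<integral>y. w y * fst (K x y) \<partial>cyl)"
  unfolding velocity_def using integral_bounded_linear[OF bounded_linear_fst integrable_K[OF assms]]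
  by simp

lemma abs_fst_velocity_le:
  assumes "x \<in> S_plus"
  shows "\<bar>fst (velocity w x)\<bar> \<le> A"
proof -
  have "ennreal (norm (velocity w x)) \<le> (\<integral>\<^sup>+ y. ennreal (norm (w y *\<^sub>R K x y)) \<partial>cyl)"
    unfolding velocity_def by (rule integral_norm_bound_ennreal[OF integrable_K[OF assms]])
  also have "\<dots> \<le> ennreal A" by (rule K_bound[OF assms])
  finally have "norm (velocity w x) \<le> A" using A_nonneg by (simp add: ennreal_le_iff)
  then show ?thesis using norm_fst_le[of "fst (velocity w x)" "snd (velocity w x)"] by simp
qed

text \<open>The inner integral over \<open>y\<close> is at most A |w x|, which is integrable. This
  justifies Fubini in the symmetrization of the impulse derivative.\<close>

lemma interaction_integrable:
  "integrable (cyl \<Otimes>\<^sub>M cyl) (\<lambda>z. w (fst z) * (w (snd z) * fst (K (fst z) (snd z))))"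
proof (rule integrableI_bounded)
  have [measurable]: "(\<lambda>z. fst (K (fst z) (snd z))) \<in> borel_measurable (cyl \<Otimes>\<^sub>M cyl)"
    by (rule measurable_compose[OF K_measurable]) (simp flip: borel_prod)
  show *: "(\<lambda>z. w (fst z) * (w (snd z) * fst (K (fst z) (snd z)))) \<in> borel_measurable (cyl \<Otimes>\<^sub>M cyl)"
    by measurable
  have "(\<integral>\<^sup>+ z. ennreal (norm (w (fst z) * (w (snd z) * fst (K (fst z) (snd z))))) \<partial>(cyl \<Otimes>\<^sub>M cyl)) =
    (\<integral>\<^sup>+ x. \<integral>\<^sup>+ y. ennreal (norm (w x * (w y * fst (K x y)))) \<partial>cyl \<partial>cyl)"
    using * by (subst cyl.nn_integral_fst[symmetric]) simp_all
  also have "\<dots> \<le> (\<integral>\<^sup>+ x. ennreal A * ennreal \<bar>w x\<bar> \<partial>cyl)"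
  proof (rule nn_integral_mono)
    fix x assume "x \<in> space cyl"
    then have x: "x \<in> S_plus" by simp
    have "(\<integral>\<^sup>+ y. ennreal (norm (w x * (w y * fst (K x y)))) \<partial>cyl) \<le>
       (\<integral>\<^sup>+ y. ennreal \<bar>w x\<bar> * ennreal (norm (w y *\<^sub>R K x y)) \<partial>cyl)"
    proof (rule nn_integral_mono)
      fix y
      have "\<bar>fst (K x y)\<bar> \<le> norm (K x y)" using norm_fst_le[of "fst (K x y)" "snd (K x y)"] by simp
      then show "ennreal (norm (w x * (w y * fst (K x y)))) \<le> ennreal \<bar>w x\<bar> * ennreal (norm (w y *\<^sub>R K x y))"
        by (auto simp: ennreal_mult[symmetric] abs_mult intro!: ennreal_leI mult_left_mono)
    qed
    also have "\<dots> = ennreal \<bar>w x\<bar> * (\<integral>\<^sup>+ y. ennreal (norm (w y *\<^sub>R K x y)) \<partial>cyl)"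
    proof (rule nn_integral_cmult)
      have [measurable]: "K x \<in> borel_measurable cyl" by (rule K_section_measurable[OF x])
      show "(\<lambda>y. ennreal (norm (w y *\<^sub>R K x y))) \<in> borel_measurable cyl" by measurable
    qed
    also have "\<dots> \<le> ennreal \<bar>w x\<bar> * ennreal A" by (intro mult_left_mono K_bound[OF x]) auto
    finally show "(\<integral>\<^sup>+ y. ennreal (norm (w x * (w y * fst (K x y)))) \<partial>cyl) \<le> ennreal A * ennreal \<bar>w x\<bar>"
      by (simp add: mult.commute)
  qed
  also have "\<dots> = ennreal A * (\<integral>\<^sup>+ x. ennreal (norm (w x)) \<partial>cyl)"
    by (simp add: nn_integral_cmult)
  also have "\<dots> < \<infinity>"
    using w_integrable by (simp add: ennreal_mult_less_top integrable_iff_bounded)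
  finally show "(\<integral>\<^sup>+ z. ennreal (norm (w (fst z) * (w (snd z) * fst (K (fst z) (snd z))))) \<partial>(cyl \<Otimes>\<^sub>M cyl)) < \<infinity>" .
qed

lemma fst_velocity_measurable: "(\<lambda>x. fst (velocity w x)) \<in> borel_measurable cyl"
proof -
  have [measurable]: "(\<lambda>z. fst (K (fst z) (snd z))) \<in> borel_measurable (cyl \<Otimes>\<^sub>M cyl)"
    by (rule measurable_compose[OF K_measurable]) (simp flip: borel_prod)
  have "(\<lambda>x. \<integral>y. w y * fst (K x y) \<partial>cyl) \<in> borel_measurable cyl"
    by (intro cyl.borel_measurable_lebesgue_integral) (simp add: split_beta')
  then show ?thesis 
    by (subst measurable_cong[where g = "\<lambda>x. \<integral>y. w y * fst (K x y) \<partial>cyl"]) (simp_all add: fst_velocity)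
qed

text \<open>Exchanging the order of integration and using the antisymmetry of the kernel shows that
  the double integral equals its own negative.\<close>

lemma integral_fst_velocity: "(\<integral>x. w x * fst (velocity w x) \<partial>cyl) = 0"
proof -
  let ?f = "\<lambda>x y. w x * (w y * fst (K x y))"
  have f: "integrable (cyl \<Otimes>\<^sub>M cyl) (case_prod ?f)"
    using interaction_integrable by (simp add: split_beta')
  have "(\<integral>x. w x * fst (velocity w x) \<partial>cyl) = (\<integral>x. \<integral>y. ?f x y \<partial>cyl \<partial>cyl)"
    by (intro Bochner_Integration.integral_cong) (simp_all add: fst_velocity)
  also have "\<dots> = (\<integral>y. \<integral>x. ?f x y \<partial>cyl \<partial>cyl)"
    by (rule cyl2.Fubini_integral[OF f, symmetric])
  also have "\<dots> = (\<integral>y. - (\<integral>x. ?f y x \<partial>cyl) \<partial>cyl)"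
    by (intro Bochner_Integration.integral_cong refl, subst integral_minus[symmetric],
        intro Bochner_Integration.integral_cong refl, subst fst_K_antisym) simp
  also have "\<dots> = - (\<integral>x. \<integral>y. ?f x y \<partial>cyl \<partial>cyl)" by simp
  also have "\<dots> = - (\<integral>x. w x * fst (velocity w x) \<partial>cyl)"
    by (intro arg_cong[where f = uminus] Bochner_Integration.integral_cong) (simp_all add: fst_velocity)
  finally show ?thesis by simp
qed

end

section \<open>Conservation of the impulse\<close>

lemma measure_preserving_integral:
  fixes f :: "real \<times> real \<Rightarrow> real"
  assumes "measure_preserving_map T" "f \<in> borel_measurable cyl"
  shows "(\<integral>x. f (T x) \<partial>cyl) = (\<integral>x. f x \<partial>cyl)"
  using integral_distr[of T cyl cyl f] assms by (simp add: measure_preserving_map_def)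

lemma measure_preserving_integrable:
  fixes f :: "real \<times> real \<Rightarrow> real"
  assumes "measure_preserving_map T" "f \<in> borel_measurable cyl"
  shows "integrable cyl (\<lambda>x. f (T x)) \<longleftrightarrow> integrable cyl f"
  using integrable_distr_eq[of T cyl cyl f] assms by (simp add: measure_preserving_map_def)

lemma measure_preserving_AE:
  assumes "measure_preserving_map T" "Measurable.pred cyl P"
  shows "(AE x in cyl. P (T x)) \<longleftrightarrow> (AE x in cyl. P x)"
proof -
  have "{x \<in> space cyl. P x} \<in> sets cyl" by (rule predE) (rule assms(2))
  moreover have T: "T \<in> cyl \<rightarrow>\<^sub>M cyl" and D: "distr cyl cyl T = cyl"
    using assms(1) by (simp_all add: measure_preserving_map_def)
  ultimately show ?thesis using AE_distr_iff[of T cyl cyl P] unfolding D by blast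
qed

lemma compactly_supported_AE:
  assumes "compactly_supported f"
  obtains R where "0 \<le> R" "AE x in cyl. f x \<noteq> 0 \<longrightarrow> fst x \<le> R"
proof -
  obtain R where R: "\<And>x. x \<in> supp f \<Longrightarrow> norm x \<le> R"
    using assms unfolding compactly_supported_def bounded_iff by blast
  have "AE x in cyl. f x \<noteq> 0 \<longrightarrow> fst x \<le> \<bar>R\<bar>"
    using AE_supp[of f]
  proof eventually_elim
    case (elim x)
    then show ?case using R[of x] norm_fst_le[of "fst x" "snd x"] by auto
  qed
  then show thesis by (intro that[of "\<bar>R\<bar>"]) auto
qed

lemma integrable_mult_of_support:
  fixes f g :: "real \<times> real \<Rightarrow> real"
  assumes f: "integrable cyl f" and supp: "AE x in cyl. f x \<noteq> 0 \<longrightarrow> \<bar>g x\<bar> \<le> R"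
    and [measurable]: "g \<in> borel_measurable cyl"
  shows "integrable cyl (\<lambda>x. f x * g x)"
proof (rule Bochner_Integration.integrable_bound)
  show "integrable cyl (\<lambda>x. R * f x)" using f by simp
  show "(\<lambda>x. f x * g x) \<in> borel_measurable cyl" using f by measurable
  show "AE x in cyl. norm (f x * g x) \<le> norm (R * f x)"
    using supp
  proof eventually_elim
    case (elim x)
    show ?case
    proof (cases "f x = 0")
      case False
      then have "\<bar>g x\<bar> * \<bar>f x\<bar> \<le> \<bar>R\<bar> * \<bar>f x\<bar>" using elim by (intro mult_right_mono) auto
      then show ?thesis by (simp add: abs_mult mult.commute)
    qed simp
  qed
qed

text \<open>At time 0 the weak solution is integrable, and composed with a measure-preserving map it
  agrees almost everywhere with the initial data.\<close>

lemma euler_solution_integrable: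
  assumes sol: "euler_solution \<omega>0 \<omega>" and meas: "\<omega>0 \<in> borel_measurable cyl"
  shows "integrable cyl \<omega>0"
proof -
  have w: "integrable cyl (\<omega> 0)"
    using sol unfolding euler_solution_def weak_solution_def by (metis order_refl)
  then have [measurable]: "\<omega> 0 \<in> borel_measurable cyl" by simp
  obtain T where T: "measure_preserving_map T" "AE x in cyl. \<omega> 0 (T x) = \<omega>0 x"
    using sol unfolding euler_solution_def by (metis order_refl)
  then have [measurable]: "T \<in> cyl \<rightarrow>\<^sub>M cyl" by (simp add: measure_preserving_map_def)
  have "integrable cyl (\<lambda>x. \<omega> 0 (T x))"
    using measure_preserving_integrable[OF T(1), of "\<omega> 0"] w by simp
  then show ?thesis
    using T(2) meas by (subst integrable_cong_AE[of _ _ "\<lambda>x. \<omega> 0 (T x)"]) (auto elim: eventually_mono)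
qed

text \<open>In Lagrangian form only the trajectories depend on time, so no derivative of the
  vorticity is taken. The trajectories are Lipschitz in time uniformly in their starting point,
  which provides the dominating function.\<close>

lemma
  assumes sol: "euler_solution \<omega>0 \<omega>" and meas [measurable]: "\<omega>0 \<in> borel_measurable cyl"
    and cs: "compactly_supported \<omega>0" and "0 \<le> T"
  shows impulse_integrable: "integrable cyl (\<lambda>x. \<omega> T x * fst x)"
    and impulse_conserved: "(\<integral>x. \<omega> T x * fst x \<partial>cyl) = (\<integral>x. \<omega>0 x * fst x \<partial>cyl)"
proof -
  obtain C where C: "\<And>t. 0 \<le> t \<Longrightarrow> integrable cyl (\<omega> t)" "\<And>t. 0 \<le> t \<Longrightarrow> (\<integral>x. \<bar>\<omega> t x\<bar> \<partial>cyl) \<le> C" 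
      "\<And>t. 0 \<le> t \<Longrightarrow> Linf_norm (\<omega> t) \<le> ereal C"
    using sol unfolding euler_solution_def weak_solution_def by metis
  obtain X where X: "flow_map (\<lambda>t. velocity (\<omega> t)) X" 
    and mp: "\<And>t. 0 \<le> t \<Longrightarrow> measure_preserving_map (X t)"
    and tr: "\<And>t. 0 \<le> t \<Longrightarrow> AE x in cyl. \<omega> t (X t x) = \<omega>0 x"
    using sol unfolding euler_solution_def by metis
  obtain Y where bij: "\<And>t. 0 \<le> t \<Longrightarrow> bij_betw (X t) S_plus S_plus"
    and Y: "\<And>x. x \<in> S_plus \<Longrightarrow> Y 0 x = x" 
      "\<And>x t. x \<in> S_plus \<Longrightarrow> 0 \<le> t \<Longrightarrow> X t x = wrap (Y t x)"
      "\<And>x t. x \<in> S_plus \<Longrightarrow> 0 \<le> t \<Longrightarrow> 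
         ((\<lambda>s. Y s x) has_vector_derivative velocity (\<omega> t) (Y t x)) (at t within {0..})"
    using X unfolding flow_map_def by metis
  have X_in: "X t x \<in> S_plus" if "x \<in> S_plus" "0 \<le> t" for t x
    using bij[OF that(2)] that(1) bij_betwE by blast
  have X_meas [measurable]: "X t \<in> cyl \<rightarrow>\<^sub>M cyl" if "0 \<le> t" for t
    using mp[OF that] by (simp add: measure_preserving_map_def)
  have wt_meas [measurable]: "\<omega> t \<in> borel_measurable cyl" if "0 \<le> t" for t using C(1)[OF that] by simp

  \<comment> \<open>A velocity bound uniform in time\<close>
  obtain A where A: "0 \<le> A" 
    "\<And>w x. w \<in> borel_measurable cyl \<Longrightarrow> AE y in cyl. \<bar>w y\<bar> \<le> C \<Longrightarrow>
      (\<integral>\<^sup>+ y. ennreal \<bar>w y\<bar> \<partial>cyl) \<le> ennreal C \<Longrightarrow> x \<in> S_plus \<Longrightarrow>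
      (\<integral>\<^sup>+ y. ennreal (norm (w y *\<^sub>R K x y)) \<partial>cyl) \<le> ennreal A"
    using nn_integral_K_bound[of C] by blast
  have bv: "bounded_vorticity (\<omega> t) A" if t: "0 \<le> t" for t
  proof
    fix x assume x: "x \<in> S_plus"
    have "(\<integral>\<^sup>+ y. ennreal \<bar>\<omega> t y\<bar> \<partial>cyl) = ennreal (\<integral>y. \<bar>\<omega> t y\<bar> \<partial>cyl)"
      using C(1)[OF t] by (intro nn_integral_eq_integral) auto
    also have "\<dots> \<le> ennreal C" using C(2)[OF t] by (rule ennreal_leI)
    finally show "(\<integral>\<^sup>+ y. ennreal (norm (\<omega> t y *\<^sub>R K x y)) \<partial>cyl) \<le> ennreal A"
      using A(2)[OF wt_meas[OF t] AE_le_Linf_norm[OF C(3)[OF t]] _ x] by blast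
  qed (use A C(1)[OF t] in auto)

  \<comment> \<open>First coordinates of the trajectories\<close>
  define p where "p t x = fst (X t x)" for t x
  define v where "v t x = fst (velocity (\<omega> t) (X t x))" for t x
  have p_meas: "p t \<in> borel_measurable cyl" if "0 \<le> t" for t
    unfolding p_def using measurable_compose[OF X_meas[OF that] fst_measurable_cyl] .
  have v_meas: "v t \<in> borel_measurable cyl" if "0 \<le> t" for t
    unfolding v_def 
    using measurable_compose[OF X_meas[OF that] bounded_vorticity.fst_velocity_measurable[OF bv[OF that]]] .
  have v_le: "\<bar>v t x\<bar> \<le> A" if "x \<in> S_plus" "0 \<le> t" for t x
    unfolding v_def by (rule bounded_vorticity.abs_fst_velocity_le[OF bv X_in]) (use that in auto)
  have p0: "p 0 x = fst x" if "x \<in> S_plus" for x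
    using that Y(1)[OF that] Y(2)[OF that, of 0] by (simp add: p_def wrap_id)
  have p_deriv: "((\<lambda>s. p s x) has_real_derivative v t x) (at t within {0..})" 
    if x: "x \<in> S_plus" and t: "0 \<le> t" for t x
  proof -
    have "((\<lambda>s. fst (Y s x)) has_vector_derivative fst (velocity (\<omega> t) (Y t x))) (at t within {0..})"
      by (rule bounded_linear.has_vector_derivative[OF bounded_linear_fst Y(3)[OF x t]])
    moreover have "velocity (\<omega> t) (Y t x) = velocity (\<omega> t) (X t x)"
      using velocity_wrap[of "\<omega> t" "Y t x"] Y(2)[OF x t] by simp
    \<comment> \<open>\<open>wrap\<close> does not touch the first coordinate, so \<open>p\<close>
      inherits the derivative of the lift even where the angle of \<open>X\<close> jumps across the
      seam.\<close>
    moreover have "p s x = fst (Y s x)" if "s \<in> {0..}" for s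
      using Y(2)[OF x, of s] that by (simp add: p_def wrap_def)
    ultimately show ?thesis
      unfolding has_real_derivative_iff_has_vector_derivative v_def
      using t by (auto intro: has_vector_derivative_transform)
  qed
  have p_Lipschitz: "\<bar>p s x - p t x\<bar> \<le> A * \<bar>s - t\<bar>" if "x \<in> S_plus" "0 \<le> t" "0 \<le> s" for s t x
    using field_differentiable_bound[of "{0..}" "\<lambda>s. p s x" "\<lambda>t. v t x" A s t]
      p_deriv v_le that by auto

  have w0_int: "integrable cyl \<omega>0" by (rule euler_solution_integrable[OF sol meas])
  obtain R where R: "0 \<le> R" "AE x in cyl. \<omega>0 x \<noteq> 0 \<longrightarrow> fst x \<le> R"
    using compactly_supported_AE[OF cs] by blast
  \<comment> \<open>A trajectory starting at first coordinate at most \<open>R\<close> moves at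
    speed at most \<open>A\<close> in that direction, hence stays below R + A t up to time
    t.\<close>
  have w0p_int: "integrable cyl (\<lambda>x. \<omega>0 x * p t x)" if t: "0 \<le> t" for t
  proof (rule integrable_mult_of_support[OF w0_int _ p_meas[OF t], where R = "R + A * t"])
    show "AE x in cyl. \<omega>0 x \<noteq> 0 \<longrightarrow> \<bar>p t x\<bar> \<le> R + A * t"
      using R(2) AE_space
    proof eventually_elim
      case (elim x)
      then have "x \<in> S_plus" by simp
      then have "\<bar>p t x - fst x\<bar> \<le> A * t" "0 < fst x"
        using p_Lipschitz[of x 0 t] p0[of x] t by (auto simp: S_plus_def)
      then show ?case using elim by auto
    qed
  qed

  \<comment> \<open>The impulse in Lagrangian and Eulerian form\<close>
  define I where "I t = (\<integral>x. \<omega>0 x * p t x \<partial>cyl)" for t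
  have I_eq: "I t = (\<integral>x. \<omega> t x * fst x \<partial>cyl)" "integrable cyl (\<lambda>x. \<omega> t x * fst x)" if t: "0 \<le> t" for t
  proof -
    have [measurable]: "\<omega> t \<in> borel_measurable cyl" "X t \<in> cyl \<rightarrow>\<^sub>M cyl" 
      "p t \<in> borel_measurable cyl" using t p_meas by auto
    have AE: "AE x in cyl. \<omega>0 x * p t x = \<omega> t (X t x) * fst (X t x)"
      using tr[OF t] by eventually_elim (simp add: p_def)
    have "I t = (\<integral>x. \<omega> t (X t x) * fst (X t x) \<partial>cyl)"
      unfolding I_def using AE by (intro integral_cong_AE) measurable
    also have "\<dots> = (\<integral>x. \<omega> t x * fst x \<partial>cyl)"
      by (rule measure_preserving_integral[OF mp[OF t]]) measurable
    finally show "I t = (\<integral>x. \<omega> t x * fst x \<partial>cyl)" .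
    have "integrable cyl (\<lambda>x. \<omega> t (X t x) * fst (X t x))"
      using w0p_int[OF t] AE by (subst integrable_cong_AE[symmetric, OF _ _ AE]) measurable
    then show "integrable cyl (\<lambda>x. \<omega> t x * fst x)"
      by (subst (asm) measure_preserving_integrable[OF mp[OF t]]) measurable
  qed
  have v_zero: "(\<integral>x. \<omega>0 x * v t x \<partial>cyl) = 0" if t: "0 \<le> t" for t
  proof -
    have [measurable]: "\<omega> t \<in> borel_measurable cyl" "X t \<in> cyl \<rightarrow>\<^sub>M cyl" "v t \<in> borel_measurable cyl"
      "(\<lambda>x. fst (velocity (\<omega> t) x)) \<in> borel_measurable cyl"
      using t v_meas bounded_vorticity.fst_velocity_measurable[OF bv] by auto
    have "(\<integral>x. \<omega>0 x * v t x \<partial>cyl) = (\<integral>x. \<omega> t (X t x) * fst (velocity (\<omega> t) (X t x)) \<partial>cyl)"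
    proof (rule integral_cong_AE)
      show "AE x in cyl. \<omega>0 x * v t x = \<omega> t (X t x) * fst (velocity (\<omega> t) (X t x))"
        using tr[OF t] by eventually_elim (simp add: v_def)
      show "(\<lambda>x. \<omega> t (X t x) * fst (velocity (\<omega> t) (X t x))) \<in> borel_measurable cyl"
        using measurable_compose[OF X_meas[OF t], of "\<lambda>x. \<omega> t x * fst (velocity (\<omega> t) x)"] by measurable
    qed measurable
    also have "\<dots> = (\<integral>x. \<omega> t x * fst (velocity (\<omega> t) x) \<partial>cyl)"
      by (rule measure_preserving_integral[OF mp[OF t]]) measurable
    also have "\<dots> = 0" by (rule bounded_vorticity.integral_fst_velocity[OF bv[OF t]])
    finally show ?thesis .
  qed

  \<comment> \<open>Vanishing of the time derivative of the impulse\<close>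
  have I_deriv: "(I has_real_derivative 0) (at t within {0..})" if t: "0 \<le> t" for t
    \<comment> \<open>The limit of the difference quotients is tested along arbitrary sequences of
      times, the form in which dominated convergence applies.\<close>
    unfolding has_field_derivative_iff tendsto_at_iff_sequentially comp_def
  proof (intro allI impI)
    fix s :: "nat \<Rightarrow> real" assume s: "\<forall>i. s i \<in> {0..} - {t}" "s \<longlonglongrightarrow> t"
    then have s0: "0 \<le> s i" "s i \<noteq> t" for i by auto
    have [measurable]: "p t \<in> borel_measurable cyl" "p (s i) \<in> borel_measurable cyl"
       "v t \<in> borel_measurable cyl" for i
      using p_meas v_meas t s0 by auto
    have "(\<lambda>i. \<integral>x. \<omega>0 x * ((p (s i) x - p t x) / (s i - t)) \<partial>cyl) \<longlonglongrightarrow> (\<integral>x. \<omega>0 x * v t x \<partial>cyl)"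
    proof (rule integral_dominated_convergence[where w = "\<lambda>x. A * \<bar>\<omega>0 x\<bar>"])
      show "integrable cyl (\<lambda>x. A * \<bar>\<omega>0 x\<bar>)" using w0_int by simp
      show "AE x in cyl. (\<lambda>i. \<omega>0 x * ((p (s i) x - p t x) / (s i - t))) \<longlonglongrightarrow> \<omega>0 x * v t x"
        using AE_space
      proof eventually_elim
        case (elim x)
        then have "((\<lambda>s. (p s x - p t x) / (s - t)) \<longlongrightarrow> v t x) (at t within {0..})"
          using p_deriv[of x t] t by (simp add: has_field_derivative_iff)
        then have "(\<lambda>i. (p (s i) x - p t x) / (s i - t)) \<longlonglongrightarrow> v t x"
          using s unfolding tendsto_at_iff_sequentially comp_def by blast
        then show ?case by (intro tendsto_intros)
      qed
      show "AE x in cyl. norm (\<omega>0 x * ((p (s i) x - p t x) / (s i - t))) \<le> A * \<bar>\<omega>0 x\<bar>" for i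
        using AE_space
      proof eventually_elim
        case (elim x)
        have "\<bar>(p (s i) x - p t x) / (s i - t)\<bar> \<le> A"
          using p_Lipschitz[of x t "s i"] elim t s0[of i] by (simp add: divide_le_eq)
        from mult_left_mono[OF this abs_ge_zero[of "\<omega>0 x"]] show ?case
          unfolding real_norm_def abs_mult by (simp only: mult.commute)
      qed
    qed measurable
    moreover have "(\<integral>x. \<omega>0 x * ((p (s i) x - p t x) / (s i - t)) \<partial>cyl) = (I (s i) - I t) / (s i - t)" for i
    proof -
      have "(\<integral>x. \<omega>0 x * ((p (s i) x - p t x) / (s i - t)) \<partial>cyl) =
         (\<integral>x. (\<omega>0 x * p (s i) x - \<omega>0 x * p t x) / (s i - t) \<partial>cyl)"
        by (simp add: right_diff_distrib)
      also have "\<dots> = (I (s i) - I t) / (s i - t)"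
        unfolding I_def using w0p_int[OF t] w0p_int[OF s0(1)[of i]] by simp
      finally show ?thesis .
    qed
    ultimately show "(\<lambda>i. (I (s i) - I t) / (s i - t)) \<longlonglongrightarrow> 0"
      unfolding v_zero[OF t] by (simp only:)
  qed
  have "\<exists>c. \<forall>t\<in>{0..}. I t = c"
    by (rule has_field_derivative_zero_constant) (use I_deriv in auto)
  then have "I T = I 0" using \<open>0 \<le> T\<close> by auto
  also have "I 0 = (\<integral>x. \<omega>0 x * fst x \<partial>cyl)"
    unfolding I_def by (intro Bochner_Integration.integral_cong) (simp_all add: p0)
  finally show "(\<integral>x. \<omega> T x * fst x \<partial>cyl) = (\<integral>x. \<omega>0 x * fst x \<partial>cyl)"
    using I_eq(1)[OF \<open>0 \<le> T\<close>] by simp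
  show "integrable cyl (\<lambda>x. \<omega> T x * fst x)" by (rule I_eq(2)[OF \<open>0 \<le> T\<close>])
qed

section \<open>The energy--Casimir functional\<close>

lemma borel_measurable_antimono:
  fixes f :: "real \<Rightarrow> real"
  assumes "\<And>r s. r \<le> s \<Longrightarrow> f s \<le> f r"
  shows "f \<in> borel_measurable borel"
proof -
  have "mono (\<lambda>r. - f r)" using assms by (auto simp: mono_def)
  then have "(\<lambda>r. - f r) \<in> borel_measurable borel" by (rule borel_measurable_mono)
  then have "(\<lambda>r. - (- f r)) \<in> borel_measurable borel" by (rule borel_measurable_uminus)
  then show ?thesis by simp
qed

lemma integrable_indicator_interval [simp]:
  fixes a b :: real
  shows "integrable lborel (indicat_real {a<..b})" "integrable lborel (indicat_real {a..b})"
proof -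
  show "integrable lborel (indicat_real {a<..b})"
  proof (rule integrable_real_indicator)
    show "emeasure lborel {a<..b} < \<infinity>" by (cases "a \<le> b") simp_all
  qed simp
  show "integrable lborel (indicat_real {a..b})"
  proof (rule integrable_real_indicator)
    show "emeasure lborel {a..b} < \<infinity>" by (cases "a \<le> b") simp_all
  qed simp
qed

lemma integrable_bounded_Ioc:
  fixes f :: "real \<Rightarrow> real"
  assumes [measurable]: "f \<in> borel_measurable borel" and "\<And>r. \<bar>f r\<bar> \<le> c"
  shows "integrable lborel (\<lambda>r. indicator {a<..b} r * f r)"
proof (rule Bochner_Integration.integrable_bound)
  show "integrable lborel (\<lambda>r. c * indicator {a..b} r)" by simp
  have "0 \<le> c" using assms(2)[of 0] by linarith
  then show "AE r in lborel. norm (indicator {a<..b} r * f r) \<le> norm (c * indicator {a..b} r)"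
    using assms(2) by (auto simp: indicator_def)
qed measurable

text \<open>The value \<open>M\<close> on the negative half line makes \<open>energy_lower_bound\<close> below hold up to the
  wall.\<close>

locale monotone_profile =
  fixes Z :: "real \<Rightarrow> real" and L M :: real
  assumes antimono_Z: "antimono Z" and Z_nonneg: "\<And>r. 0 \<le> Z r" and Z_le: "\<And>r. Z r \<le> M"
    and Z_left: "\<And>r. r \<le> 0 \<Longrightarrow> Z r = M" and Z_right: "\<And>r. L < r \<Longrightarrow> Z r = 0"
    and L_pos: "0 < L"
begin

lemma ZD: "r \<le> s \<Longrightarrow> Z s \<le> Z r"
  using antimono_Z by (auto simp: antimono_def)

lemma M_nonneg: "0 \<le> M"
  using Z_nonneg Z_le order_trans by blast

lemma Z_meas [measurable]: "Z \<in> borel_measurable borel"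
  by (rule borel_measurable_antimono) (rule ZD)

text \<open>Beyond \<open>L\<close> the profile vanishes, so the cut loses nothing for
  \<open>v \<ge> 0\<close>; for negative \<open>v\<close> it keeps the integral finite.\<close>

definition casimir :: "real \<Rightarrow> real" where
  "casimir v = (\<integral>r. indicator {0<..L} r * min (Z r) v \<partial>lborel)"

text \<open>The normalization that makes the energy vanish at the profile. It depends on position
  only, so its integral is the same at all times.\<close>

definition tail :: "real \<Rightarrow> real" where
  "tail y = (\<integral>r. indicator {y<..L} r * Z r \<partial>lborel)"

definition energy :: "real \<Rightarrow> real \<Rightarrow> real" where
  "energy y v = y * v - casimir v + tail y"

lemma integrable_min: "integrable lborel (\<lambda>r. indicator {a<..b} r * min (Z r) v)"
proof (rule integrable_bounded_Ioc[where c = "M + \<bar>v\<bar>"])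
  show "\<bar>min (Z r) v\<bar> \<le> M + \<bar>v\<bar>" for r using Z_nonneg[of r] Z_le[of r] by (auto simp: min_def)
qed measurable

lemma integrable_Z: "integrable lborel (\<lambda>r. indicator {a<..b} r * Z r)"
  by (rule integrable_bounded_Ioc[where c = M]) (measurable, use Z_nonneg Z_le in auto)

text \<open>For \<open>0 < y\<close> and \<open>0 \<le> v\<close> this density is \<open>(v - Z)\<^sup>+\<close> on \<open>(0, y]\<close> and \<open>(Z - v)\<^sup>+\<close> on \<open>(y, \<infinity>)\<close>, so
  that the energy is minimal, with value \<open>0\<close>, at \<open>v = Z y\<close>.\<close>

definition energy_density :: "real \<Rightarrow> real \<Rightarrow> real \<Rightarrow> real" where
  "energy_density y v r =
     indicator {0<..y} r * v - indicator {0<..L} r * min (Z r) v + indicator {y<..L} r * Z r"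

lemma integrable_energy_density: "integrable lborel (energy_density y v)"
  unfolding energy_density_def using integrable_min integrable_Z
  by (intro Bochner_Integration.integrable_add Bochner_Integration.integrable_diff) auto

lemma energy_eq:
  assumes "0 \<le> y"
  shows "energy y v = (\<integral>r. energy_density y v r \<partial>lborel)"
proof -
  have "integrable lborel (\<lambda>r. indicator {0<..y} r * v)" by auto
  then have "(\<integral>r. energy_density y v r \<partial>lborel) = 
     (\<integral>r. indicator {0<..y} r * v \<partial>lborel) - casimir v + tail y"
    unfolding energy_density_def casimir_def tail_def using integrable_min integrable_Z
    by (subst Bochner_Integration.integral_add, simp, simp, subst Bochner_Integration.integral_diff) auto
  also have "(\<integral>r. indicator {0<..y} r * v \<partial>lborel) = y * v" using assms by simp
  finally show ?thesis by (simp add: energy_def)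
qed

lemma energy_density_nonneg:
  assumes "0 < y" "0 \<le> v"
  shows "0 \<le> energy_density y v r"
  using assms Z_nonneg[of r] by (auto simp: energy_density_def indicator_def)

lemma energy_nonneg: "0 < y \<Longrightarrow> 0 \<le> v \<Longrightarrow> 0 \<le> energy y v"
  by (simp add: energy_eq integral_nonneg energy_density_nonneg)

lemma energy_profile:
  assumes "0 < y"
  shows "energy y (Z y) = 0"
proof -
  have "energy_density y (Z y) r = 0" for r
    using assms ZD[of r y] ZD[of y r] Z_right[of r] Z_right[of y]
    by (cases "r \<le> y") (auto simp: energy_density_def indicator_def)
  then show ?thesis using assms by (simp add: energy_eq)
qed

lemma energy_ge_Ioc:
  assumes "0 < y" "a \<le> b" and "\<And>r. indicator {a<..b} r * c \<le> energy_density y v r"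
  shows "(b - a) * c \<le> energy y v"
proof -
  have "(b - a) * c = (\<integral>r. indicator {a<..b} r * c \<partial>lborel)" using assms(2) by simp
  also have "\<dots> \<le> (\<integral>r. energy_density y v r \<partial>lborel)"
    by (rule integral_mono) (use assms(3) integrable_energy_density in auto)
  also have "\<dots> = energy y v" using assms by (simp add: energy_eq)
  finally show ?thesis .
qed

text \<open>If \<open>v\<close> lies above the profile, the density on the interval of length
  \<open>l\<close> to the left of \<open>y\<close> is at least v - Z (y - l); if below, it is at
  least Z (y + l) - v on the interval to the right. Replacing the shifted values by
  \<open>Z y\<close> costs at most \<open>l\<close> times the oscillation Z (y - l) - Z (y +
  l).\<close>

lemma energy_lower_bound:
  assumes "0 < y" "0 \<le> v" "0 < l"
  shows "l * \<bar>min v M - Z y\<bar> \<le> energy y v + l * (Z (y - l) - Z (y + l))"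
proof (cases "Z y \<le> min v M")
  case True
  show ?thesis
  proof (cases "y \<le> l")
    case True
    \<comment> \<open>The left interval would cross the wall here. There Z (y - l) = M, so the
      oscillation alone bounds the truncated value; this is why \<open>v\<close> is cut at
      \<open>M\<close>.\<close>
    have "\<bar>min v M - Z y\<bar> \<le> Z (y - l) - Z (y + l)"
      using \<open>Z y \<le> min v M\<close> Z_left[of "y - l"] ZD[of y "y + l"] True assms by auto
    then have "l * \<bar>min v M - Z y\<bar> \<le> l * (Z (y - l) - Z (y + l))" using assms by (intro mult_left_mono) auto
    then show ?thesis using energy_nonneg[OF assms(1,2)] by linarith
  next
    case False
    have "(y - (y - l)) * (v - Z (y - l)) \<le> energy y v"
    proof (rule energy_ge_Ioc)
      fix r
      show "indicator {y - l<..y} r * (v - Z (y - l)) \<le> energy_density y v r"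
      proof (cases "r \<in> {y - l<..y}")
        case True
        then show ?thesis using False assms ZD[of "y - l" r] Z_nonneg[of "y - l"]
          by (auto simp: energy_density_def indicator_def)
      next
        case False
        then show ?thesis using energy_density_nonneg[OF assms(1,2)] by simp
      qed
    qed (use assms in auto)
    then have "l * (v - Z (y - l)) \<le> energy y v" by simp
    moreover have "l * (min v M - Z y) \<le> l * (v - Z (y - l)) + l * (Z (y - l) - Z (y + l))"
      using ZD[of y "y + l"] assms by (simp add: distrib_left[symmetric])
    ultimately show ?thesis using True by simp
  qed
next
  case False
  then have v: "v < Z y" "min v M = v" using Z_le[of y] by auto
  have "((y + l) - y) * (Z (y + l) - v) \<le> energy y v"
  proof (rule energy_ge_Ioc)
    fix r
    show "indicator {y<..y + l} r * (Z (y + l) - v) \<le> energy_density y v r"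
    proof (cases "r \<in> {y<..y + l}")
      case True
      then show ?thesis using assms ZD[of r "y + l"] Z_right[of "y + l"] Z_nonneg[of r]
        by (auto simp: energy_density_def indicator_def)
    next
      case False
      then show ?thesis using energy_density_nonneg[OF assms(1,2)] by simp
    qed
  qed (use assms in auto)
  moreover have "l * (Z y - v) \<le> l * (Z (y + l) - v) + l * (Z (y - l) - Z (y + l))"
    using ZD[of "y - l" y] assms by (simp add: distrib_left[symmetric])
  ultimately show ?thesis using v by simp
qed

text \<open>The truncation \<open>min (Z r)\<close> is 1-Lipschitz and the interval of integration
  has length \<open>L\<close>. Both the integrability of the Casimir and the bound on the initial
  energy rest on this.\<close>

lemma casimir_Lipschitz: "\<bar>casimir u - casimir v\<bar> \<le> L * \<bar>u - v\<bar>"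
proof -
  define d where "d r = min (Z r) u - min (Z r) v" for r
  have d: "\<bar>d r\<bar> \<le> \<bar>u - v\<bar>" for r unfolding d_def by linarith
  have [measurable]: "d \<in> borel_measurable borel" unfolding d_def by measurable
  have int: "integrable lborel (\<lambda>r. indicator {0<..L} r * d r)"
    by (rule integrable_bounded_Ioc[OF _ d]) measurable
  have "casimir u - casimir v = (\<integral>r. indicator {0<..L} r * d r \<partial>lborel)"
    unfolding casimir_def d_def right_diff_distrib using integrable_min by simp
  also have "\<bar>\<dots>\<bar> \<le> (\<integral>r. \<bar>indicator {0<..L} r * d r\<bar> \<partial>lborel)"
    by (rule integral_abs_bound)
  also have "\<dots> \<le> (\<integral>r. indicator {0<..L} r * \<bar>u - v\<bar> \<partial>lborel)"
  proof (rule integral_mono[OF integrable_abs[OF int]])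
    show "integrable lborel (\<lambda>r. indicator {0<..L} r * \<bar>u - v\<bar>)"
      using integrable_indicator_interval(1)[of 0 L] by (rule integrable_mult_left)
    show "\<bar>indicator {0<..L} r * d r\<bar> \<le> indicator {0<..L} r * \<bar>u - v\<bar>" for r
      using d[of r] by (simp add: indicator_def)
  qed
  also have "\<dots> = L * \<bar>u - v\<bar>" using L_pos by (subst integral_mult_left_zero) simp
  finally show ?thesis .
qed

lemma casimir_0: "casimir 0 = 0"
  using Z_nonneg by (simp add: casimir_def min_absorb2)

lemma casimir_meas [measurable]: "casimir \<in> borel_measurable borel"
proof (rule borel_measurable_mono, rule monoI)
  fix u v :: real assume "u \<le> v"
  then show "casimir u \<le> casimir v"
    unfolding casimir_def by (intro integral_mono integrable_min mult_left_mono) auto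
qed

lemma tail_meas [measurable]: "tail \<in> borel_measurable borel"
proof (rule borel_measurable_antimono)
  fix r s :: real assume "r \<le> s"
  then show "tail s \<le> tail r"
    unfolding tail_def by (intro integral_mono integrable_Z mult_right_mono Z_nonneg) (auto simp: indicator_def)
qed

section \<open>Integrability of functions of the first coordinate\<close>

lemma integrable_cyl_fst:
  fixes h :: "real \<Rightarrow> real"
  assumes [measurable]: "h \<in> borel_measurable borel" and "\<And>r. 0 < r \<Longrightarrow> \<bar>h r\<bar> \<le> c" 
    and "\<And>r. L < r \<Longrightarrow> h r = 0"
  shows "integrable cyl (\<lambda>x. h (fst x))"
proof (rule integrableI_bounded)
  have [measurable]: "(\<lambda>x. h (fst x)) \<in> borel_measurable cyl"
    by (rule measurable_compose[OF fst_measurable_cyl]) measurable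
  show "(\<lambda>x. h (fst x)) \<in> borel_measurable cyl" by measurable
  have "(\<integral>\<^sup>+ x. ennreal (norm (h (fst x))) \<partial>cyl) = 
     ennreal (2 * pi) * (\<integral>\<^sup>+ r. ennreal (norm (h r)) * indicator {0<..} r \<partial>lborel)"
    by (rule nn_integral_cyl_fst) measurable
  also have "(\<integral>\<^sup>+ r. ennreal (norm (h r)) * indicator {0<..} r \<partial>lborel) \<le> 
    (\<integral>\<^sup>+ r. ennreal c * indicator {0..L} r \<partial>lborel)"
    using assms(2,3) by (intro nn_integral_mono) (auto simp: indicator_def not_le intro!: ennreal_leI)
  then have "ennreal (2 * pi) * (\<integral>\<^sup>+ r. ennreal (norm (h r)) * indicator {0<..} r \<partial>lborel) \<le>
    ennreal (2 * pi) * (\<integral>\<^sup>+ r. ennreal c * indicator {0..L} r \<partial>lborel)" by (intro mult_left_mono) auto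
  also have "\<dots> < \<infinity>" by (simp add: nn_integral_cmult ennreal_mult_less_top emeasure_lborel_Icc_eq)
  finally show "(\<integral>\<^sup>+ x. ennreal (norm (h (fst x))) \<partial>cyl) < \<infinity>" .
qed

lemma integrable_cyl_Z: "integrable cyl (\<lambda>x. Z (fst x))"
  by (rule integrable_cyl_fst[where c = M]) (use Z_nonneg Z_le Z_right in auto)

lemma integrable_cyl_Z_fst: "integrable cyl (\<lambda>x. Z (fst x) * fst x)"
proof (rule integrable_mult_of_support[OF integrable_cyl_Z, where R = L])
  show "AE x in cyl. Z (fst x) \<noteq> 0 \<longrightarrow> \<bar>fst x\<bar> \<le> L"
    using AE_space
  proof eventually_elim
    case (elim x)
    then show ?case using Z_right[of "fst x"] by (cases "L < fst x") (auto simp: S_plus_def)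
  qed
qed measurable

lemma integrable_cyl_tail: "integrable cyl (\<lambda>x. tail (fst x))"
proof (rule integrable_cyl_fst[where c = "L * M"])
  fix r :: real assume r: "0 < r"
  have "0 \<le> tail r" unfolding tail_def using Z_nonneg by (intro integral_nonneg_AE) auto
  moreover have "tail r \<le> (\<integral>s. indicator {0<..L} s * M \<partial>lborel)"
    unfolding tail_def
  proof (rule integral_mono[OF integrable_Z])
    show "integrable lborel (\<lambda>s. indicator {0<..L} s * M)" by simp
    show "indicator {r<..L} s * Z s \<le> indicator {0<..L} s * M" for s
      using r Z_le M_nonneg by (auto simp: indicator_def)
  qed
  ultimately show "\<bar>tail r\<bar> \<le> L * M" using L_pos by simp
next
  fix r assume "L < r"
  then show "tail r = 0" by (simp add: tail_def)
qed measurable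

text \<open>Adding the integral \<open>T\<close> of \<open>Z\<close> over (l, \<infinity>) to that
  of the difference gives the integral of \<open>Z\<close> over (-l, \<infinity>). What remains is
  the integral over (-l, l], at most 2 l M, and the angle contributes 2 pi.\<close>

lemma integral_Z_shift_le:
  assumes "0 < l"
  shows "(\<integral>x. Z (fst x - l) - Z (fst x + l) \<partial>cyl) \<le> 4 * pi * M * l"
    "integrable cyl (\<lambda>x. Z (fst x - l) - Z (fst x + l))"
proof -
  define T where "T = (\<integral>\<^sup>+ r. ennreal (Z r) * indicator {l<..} r \<partial>lborel)"
  have diff_nonneg: "0 \<le> Z (r - l) - Z (r + l)" for r using ZD[of "r - l" "r + l"] assms by simp
  have "T \<le> (\<integral>\<^sup>+ r. ennreal M * indicator {0..L} r \<partial>lborel)"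
    unfolding T_def using assms Z_le Z_right
    by (intro nn_integral_mono) (auto simp: indicator_def not_le intro!: ennreal_leI)
  also have "\<dots> < \<infinity>" by (simp add: nn_integral_cmult ennreal_mult_less_top emeasure_lborel_Icc_eq)
  finally have T: "T < \<infinity>" .
  have shift: "(\<integral>\<^sup>+ r. f (c + r) \<partial>lborel) = (\<integral>\<^sup>+ r. f r \<partial>lborel)"
    if "f \<in> borel_measurable borel" for f :: "real \<Rightarrow> ennreal" and c
    using nn_integral_real_affine[OF that, of 1 c] by simp
  have "(\<integral>\<^sup>+ r. ennreal (Z (r - l) - Z (r + l)) * indicator {0<..} r \<partial>lborel) + T =
    (\<integral>\<^sup>+ r. ennreal (Z (r - l) - Z (r + l)) * indicator {0<..} r \<partial>lborel) +
    (\<integral>\<^sup>+ r. ennreal (Z (l + r)) * indicator {l<..} (l + r) \<partial>lborel)"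
    unfolding T_def by (subst shift) auto
  also have "\<dots> = (\<integral>\<^sup>+ r. ennreal (Z (r - l) - Z (r + l)) * indicator {0<..} r +
      ennreal (Z (l + r)) * indicator {l<..} (l + r) \<partial>lborel)"
    by (rule nn_integral_add[symmetric]) measurable
  also have "\<dots> = (\<integral>\<^sup>+ r. ennreal (Z (- l + r)) * indicator {-l<..} (- l + r) \<partial>lborel)"
    using diff_nonneg Z_nonneg
    by (intro nn_integral_cong) (auto simp: indicator_def ennreal_plus[symmetric] add.commute simp del: ennreal_plus)
  also have "\<dots> = (\<integral>\<^sup>+ r. ennreal (Z r) * indicator {-l<..} r \<partial>lborel)"
    by (rule shift) measurable
  also have "\<dots> = (\<integral>\<^sup>+ r. ennreal (Z r) * indicator {-l<..l} r + ennreal (Z r) * indicator {l<..} r \<partial>lborel)"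
    using assms by (intro nn_integral_cong) (auto simp: indicator_def)
  also have "\<dots> = (\<integral>\<^sup>+ r. ennreal (Z r) * indicator {-l<..l} r \<partial>lborel) + T"
    unfolding T_def by (rule nn_integral_add) measurable
  \<comment> \<open>Finiteness of \<open>T\<close> allows it to be cancelled in
    \<open>ennreal\<close>.\<close>
  finally have "(\<integral>\<^sup>+ r. ennreal (Z (r - l) - Z (r + l)) * indicator {0<..} r \<partial>lborel) =
    (\<integral>\<^sup>+ r. ennreal (Z r) * indicator {-l<..l} r \<partial>lborel)" using T by (auto simp: less_top[symmetric])
  also have "\<dots> \<le> (\<integral>\<^sup>+ r. ennreal M * indicator {-l<..l} r \<partial>lborel)"
    using Z_le by (intro nn_integral_mono) (auto simp: indicator_def intro!: ennreal_leI)
  also have "\<dots> = ennreal (2 * l * M)"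
    using assms M_nonneg by (simp add: nn_integral_cmult ennreal_mult[symmetric] mult.commute)
  finally have *: "(\<integral>\<^sup>+ r. ennreal (Z (r - l) - Z (r + l)) * indicator {0<..} r \<partial>lborel) \<le> ennreal (2 * l * M)" .
  have "(\<integral>\<^sup>+ x. ennreal (norm (Z (fst x - l) - Z (fst x + l))) \<partial>cyl) =
     (\<integral>\<^sup>+ x. ennreal (Z (fst x - l) - Z (fst x + l)) \<partial>cyl)"
    using diff_nonneg by (intro nn_integral_cong) auto
  also have "\<dots> = ennreal (2 * pi) * (\<integral>\<^sup>+ r. ennreal (Z (r - l) - Z (r + l)) * indicator {0<..} r \<partial>lborel)"
    by (rule nn_integral_cyl_fst) measurable
  also have "\<dots> \<le> ennreal (2 * pi) * ennreal (2 * l * M)" by (intro mult_left_mono *) auto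
  also have "\<dots> = ennreal (4 * pi * M * l)"
    using assms M_nonneg by (simp add: ennreal_mult[symmetric] mult_ac)
  finally have **: "(\<integral>\<^sup>+ x. ennreal (norm (Z (fst x - l) - Z (fst x + l))) \<partial>cyl) \<le> ennreal (4 * pi * M * l)" .
  show "(\<integral>x. Z (fst x - l) - Z (fst x + l) \<partial>cyl) \<le> 4 * pi * M * l"
    by (rule integral_real_bounded) (use assms M_nonneg diff_nonneg ** in auto)
  show "integrable cyl (\<lambda>x. Z (fst x - l) - Z (fst x + l))"
  proof (rule integrableI_bounded)
    show "(\<lambda>x. Z (fst x - l) - Z (fst x + l)) \<in> borel_measurable cyl"
      by (rule measurable_compose[OF fst_measurable_cyl]) measurable
  qed (use le_less_trans[OF **] in simp)
qed

end

section \<open>Stability\<close>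

text \<open>A static comparison: time enters only through the equality of the impulses and of the
  distributions of \<open>w\<close> and \<open>w0\<close>.\<close>

lemma (in monotone_profile) J1_stability:
  assumes w: "integrable cyl w" "integrable cyl (\<lambda>x. w x * fst x)" "AE x in cyl. 0 \<le> w x"
    and w0: "integrable cyl w0" "integrable cyl (\<lambda>x. w0 x * fst x)" "AE x in cyl. 0 \<le> w0 x"
    and impulse: "(\<integral>x. w x * fst x \<partial>cyl) = (\<integral>x. w0 x * fst x \<partial>cyl)"
    and equidistributed: "\<And>f :: real \<Rightarrow> real. f \<in> borel_measurable borel \<Longrightarrow>
      (\<integral>x. f (w x) \<partial>cyl) = (\<integral>x. f (w0 x) \<partial>cyl)"
    and \<delta>: "\<delta> = (\<integral>x. (1 + fst x) * \<bar>w0 x - Z (fst x)\<bar> \<partial>cyl)"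
  shows "integrable cyl (\<lambda>x. (1 + fst x) * \<bar>w x - Z (fst x)\<bar>)"
    and "(\<integral>x. (1 + fst x) * \<bar>w x - Z (fst x)\<bar> \<partial>cyl) \<le>
      ((1 + 2 * L) * (1 + L + 4 * pi * M) + 1) * (\<delta> powr (1/2) + \<delta>)"
proof -
  note int = integrable_cyl_Z integrable_cyl_Z_fst integrable_cyl_tail
  have [measurable]: "w \<in> borel_measurable cyl" "w0 \<in> borel_measurable cyl" using w(1) w0(1) by auto
  have Zm [measurable]: "(\<lambda>x. Z (fst x)) \<in> borel_measurable cyl" using integrable_cyl_Z by simp
  have d_int: "integrable cyl (\<lambda>x. \<bar>f x - Z (fst x)\<bar>)" if "integrable cyl f" for f
    using that int by simp
  have wd_int: "integrable cyl (\<lambda>x. (1 + fst x) * \<bar>f x - Z (fst x)\<bar>)"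
    if "integrable cyl f" "integrable cyl (\<lambda>x. f x * fst x)" for f
  proof -
    have "integrable cyl (\<lambda>x. \<bar>(f x - Z (fst x)) + (f x * fst x - Z (fst x) * fst x)\<bar>)"
      using that int by (intro integrable_abs Bochner_Integration.integrable_add Bochner_Integration.integrable_diff)
    moreover have "\<bar>(f x - Z (fst x)) + (f x * fst x - Z (fst x) * fst x)\<bar> = (1 + fst x) * \<bar>f x - Z (fst x)\<bar>"
      if "x \<in> space cyl" for x
    proof -
      have "(f x - Z (fst x)) + (f x * fst x - Z (fst x) * fst x) = (1 + fst x) * (f x - Z (fst x))"
        by (simp add: algebra_simps)
      then show ?thesis using that by (simp add: abs_mult S_plus_def)
    qed
    ultimately show ?thesis by (subst Bochner_Integration.integrable_cong[OF refl]) auto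
  qed
  show J_int: "integrable cyl (\<lambda>x. (1 + fst x) * \<bar>w x - Z (fst x)\<bar>)" by (rule wd_int[OF w(1,2)])
  note J0_int = wd_int[OF w0(1,2)]
  have \<delta>_nonneg: "0 \<le> \<delta>"
    unfolding \<delta> using AE_space by (intro integral_nonneg_AE, eventually_elim) (auto simp: S_plus_def)

  \<comment> \<open>Equality of the energies and the initial energy bound\<close>
  have casimir_int: "integrable cyl (\<lambda>x. casimir (f x))" if "integrable cyl f" for f
  proof (rule Bochner_Integration.integrable_bound)
    show "integrable cyl (\<lambda>x. L * f x)" using that by simp
    show "(\<lambda>x. casimir (f x)) \<in> borel_measurable cyl" using that by measurable
    show "AE x in cyl. norm (casimir (f x)) \<le> norm (L * f x)"
      using casimir_Lipschitz[of _ 0] L_pos by (simp add: casimir_0 abs_mult)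
  qed
  have energy_int: "integrable cyl (\<lambda>x. energy (fst x) (f x))"
    and energy_integral: "(\<integral>x. energy (fst x) (f x) \<partial>cyl) =
       (\<integral>x. f x * fst x \<partial>cyl) - (\<integral>x. casimir (f x) \<partial>cyl) + (\<integral>x. tail (fst x) \<partial>cyl)"
    if "integrable cyl f" "integrable cyl (\<lambda>x. f x * fst x)" for f
    unfolding energy_def using that casimir_int[OF that(1)] int by (simp_all add: mult.commute[of "fst _"])
  have "(\<integral>x. energy (fst x) (w x) \<partial>cyl) = (\<integral>x. energy (fst x) (w0 x) \<partial>cyl)"
    by (simp add: energy_integral w w0 impulse equidistributed)
  also have "\<dots> \<le> (\<integral>x. (1 + L) * ((1 + fst x) * \<bar>w0 x - Z (fst x)\<bar>) \<partial>cyl)"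
  proof (rule integral_mono_AE)
    show "integrable cyl (\<lambda>x. energy (fst x) (w0 x))" by (rule energy_int[OF w0(1,2)])
    show "integrable cyl (\<lambda>x. (1 + L) * ((1 + fst x) * \<bar>w0 x - Z (fst x)\<bar>))" using J0_int by simp
    show "AE x in cyl. energy (fst x) (w0 x) \<le> (1 + L) * ((1 + fst x) * \<bar>w0 x - Z (fst x)\<bar>)"
      using AE_space
    proof eventually_elim
      case (elim x)
      let ?d = "w0 x - Z (fst x)"
      have x: "0 < fst x" using elim by (simp add: S_plus_def)
      \<comment> \<open>Subtracting the vanishing energy of the profile cancels \<open>tail\<close>
        and leaves increments that are Lipschitz in w0 - Z.\<close>
      have "energy (fst x) (w0 x) = energy (fst x) (w0 x) - energy (fst x) (Z (fst x))"
        using energy_profile[OF x] by simp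
      also have "\<dots> = fst x * ?d - (casimir (w0 x) - casimir (Z (fst x)))"
        by (simp add: energy_def algebra_simps)
      also have "\<dots> \<le> fst x * \<bar>?d\<bar> + L * \<bar>?d\<bar>"
        using casimir_Lipschitz[of "w0 x" "Z (fst x)"] mult_left_mono[OF abs_ge_self[of ?d], of "fst x"] x
        by linarith
      also have "\<dots> = (fst x + L) * \<bar>?d\<bar>" by (simp add: algebra_simps)
      also have "\<dots> \<le> ((1 + L) * (1 + fst x)) * \<bar>?d\<bar>"
        using x L_pos by (intro mult_right_mono) (auto simp: algebra_simps)
      finally show ?case by (simp add: mult.assoc)
    qed
  qed
  also have "\<dots> = (1 + L) * \<delta>" unfolding \<delta> by simp
  finally have energy_le: "(\<integral>x. energy (fst x) (w x) \<partial>cyl) \<le> (1 + L) * \<delta>" .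

  \<comment> \<open>The distance of the truncated vorticity to the profile\<close>
  have min_int: "integrable cyl (\<lambda>x. \<bar>min (w x) M - Z (fst x)\<bar>)"
  proof (rule Bochner_Integration.integrable_bound[OF d_int[OF w(1)]])
    show "AE x in cyl. norm \<bar>min (w x) M - Z (fst x)\<bar> \<le> norm \<bar>w x - Z (fst x)\<bar>"
    proof (rule AE_I2)
      show "norm \<bar>min (w x) M - Z (fst x)\<bar> \<le> norm \<bar>w x - Z (fst x)\<bar>" for x
        using Z_le[of "fst x"] by simp
    qed
  qed measurable
  define D where "D = (\<integral>x. \<bar>min (w x) M - Z (fst x)\<bar> \<partial>cyl)"
  have D_le: "l * D \<le> (1 + L) * \<delta> + l * (4 * pi * M * l)" if l: "0 < l" for l
  proof -
    have "l * D = (\<integral>x. l * \<bar>min (w x) M - Z (fst x)\<bar> \<partial>cyl)" by (simp add: D_def)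
    also have "\<dots> \<le> (\<integral>x. energy (fst x) (w x) + l * (Z (fst x - l) - Z (fst x + l)) \<partial>cyl)"
    proof (rule integral_mono_AE)
      show "integrable cyl (\<lambda>x. l * \<bar>min (w x) M - Z (fst x)\<bar>)" using min_int by simp
      show "integrable cyl (\<lambda>x. energy (fst x) (w x) + l * (Z (fst x - l) - Z (fst x + l)))"
        using energy_int[OF w(1,2)] integral_Z_shift_le(2)[OF l] 
        by (intro Bochner_Integration.integrable_add integrable_mult_right)
      show "AE x in cyl. l * \<bar>min (w x) M - Z (fst x)\<bar> \<le> 
          energy (fst x) (w x) + l * (Z (fst x - l) - Z (fst x + l))"
        using AE_space w(3)
        by eventually_elim (rule energy_lower_bound, auto simp: S_plus_def l)
    qed
    also have "\<dots> = (\<integral>x. energy (fst x) (w x) \<partial>cyl) + l * (\<integral>x. Z (fst x - l) - Z (fst x + l) \<partial>cyl)"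
      using energy_int[OF w(1,2)] integral_Z_shift_le(2)[OF l]
      by (subst Bochner_Integration.integral_add[OF _ integrable_mult_right]) simp_all
    also have "\<dots> \<le> (1 + L) * \<delta> + l * (4 * pi * M * l)"
      using energy_le integral_Z_shift_le(1)[OF l] l by (intro add_mono mult_left_mono) auto
    finally show ?thesis .
  qed
  define s where "s = \<delta> powr (1/2)"
  have s: "0 \<le> s" "s * s = \<delta>" using \<delta>_nonneg by (auto simp: s_def powr_half_sqrt)
  have D: "D \<le> (1 + L + 4 * pi * M) * s"
  \<comment> \<open>For s > 0 the choice l = s balances the two terms of \<open>D_le\<close>. For s
    = 0 only D \<le> 4 pi M l is left, for every l > 0 and not just one.\<close>
  proof (cases "s = 0")
    case True
    have "D \<le> 0"
    proof (rule ccontr)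
      assume "\<not> D \<le> 0"
      \<comment> \<open>With this \<open>l\<close>, D = (8 pi M + 1) l exceeds 4 pi M l; the summand
        1 keeps the denominator positive when \<open>M\<close> is 0.\<close>
      define l where "l = D / (8 * pi * M + 1)"
      have M8: "0 < 8 * pi * M + 1" using M_nonneg by (simp add: add_nonneg_pos)
      have l: "0 < l" using \<open>\<not> D \<le> 0\<close> M8 by (simp add: l_def)
      have "D = l * (8 * pi * M + 1)" using M8 by (simp add: l_def)
      moreover have "l * D \<le> l * (4 * pi * M * l)" using D_le[OF l] s True by simp
      then have "D \<le> 4 * pi * M * l" using l by simp
      moreover have "0 \<le> 4 * pi * M * l" using l M_nonneg by simp
      ultimately show False using l by (simp add: algebra_simps)
    qed
    then show ?thesis using True by simp
  next
    case False
    then have "s * D \<le> s * ((1 + L + 4 * pi * M) * s)"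
      using D_le[of s] s by (simp add: algebra_simps)
    then show ?thesis using False s by simp
  qed

  \<comment> \<open>The excess above M and the unweighted distance\<close>
  define N where "N = (\<integral>x. \<bar>w x - Z (fst x)\<bar> \<partial>cyl)"
  have excess_int: "integrable cyl (\<lambda>x. max 0 (f x - M))" if f: "integrable cyl f" for f
  proof (rule Bochner_Integration.integrable_bound[OF f])
    show "(\<lambda>x. max 0 (f x - M)) \<in> borel_measurable cyl" using f by measurable
    show "AE x in cyl. norm (max 0 (f x - M)) \<le> norm (f x)" using M_nonneg by auto
  qed
  have "(\<integral>x. max 0 (w x - M) \<partial>cyl) = (\<integral>x. max 0 (w0 x - M) \<partial>cyl)"
    by (rule equidistributed) measurable
  also have "\<dots> \<le> \<delta>"
    unfolding \<delta>
  proof (rule integral_mono_AE[OF excess_int[OF w0(1)] J0_int])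
    show "AE x in cyl. max 0 (w0 x - M) \<le> (1 + fst x) * \<bar>w0 x - Z (fst x)\<bar>"
      using AE_space
    proof eventually_elim
      case (elim x)
      have "max 0 (w0 x - M) \<le> \<bar>w0 x - Z (fst x)\<bar>" using Z_le[of "fst x"] by linarith
      also have "\<dots> \<le> (1 + fst x) * \<bar>w0 x - Z (fst x)\<bar>"
        using elim by (simp add: S_plus_def distrib_right)
      finally show ?case .
    qed
  qed
  finally have excess: "(\<integral>x. max 0 (w x - M) \<partial>cyl) \<le> \<delta>" .
  have "N \<le> (\<integral>x. \<bar>min (w x) M - Z (fst x)\<bar> + max 0 (w x - M) \<partial>cyl)"
    unfolding N_def
  proof (rule integral_mono[OF d_int[OF w(1)]])
    show "integrable cyl (\<lambda>x. \<bar>min (w x) M - Z (fst x)\<bar> + max 0 (w x - M))"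
      using min_int excess_int[OF w(1)] by simp
    show "\<bar>w x - Z (fst x)\<bar> \<le> \<bar>min (w x) M - Z (fst x)\<bar> + max 0 (w x - M)" for x
      by linarith
  qed
  also have "\<dots> = D + (\<integral>x. max 0 (w x - M) \<partial>cyl)"
    unfolding D_def using min_int excess_int[OF w(1)] by simp
  also have "\<dots> \<le> (1 + L + 4 * pi * M) * s + \<delta>" using D excess by simp
  finally have N: "N \<le> (1 + L + 4 * pi * M) * s + \<delta>" .

  \<comment> \<open>Recovery of the weight from the impulse\<close>
  have pointwise: "(1 + fst x) * \<bar>w x - Z (fst x)\<bar> \<le> 
      (1 + 2 * L) * \<bar>w x - Z (fst x)\<bar> + (w x * fst x - Z (fst x) * fst x)" 
    if "x \<in> space cyl" "0 \<le> w x" for x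
  \<comment> \<open>Up to \<open>L\<close> the weight is at most \<open>L\<close>, and doubling this
    term pays for a negative sign of w - Z. Beyond \<open>L\<close> the profile vanishes, so w - Z =
    w is nonnegative and the signed weighted term is already the weighted distance.\<close>
  proof (cases "fst x \<le> L")
    case True
    have x: "0 < fst x" using that by (simp add: S_plus_def)
    have "- \<bar>w x - Z (fst x)\<bar> \<le> w x - Z (fst x)" by linarith
    from mult_left_mono[OF this, of "fst x"] x
    have "- (fst x * \<bar>w x - Z (fst x)\<bar>) \<le> w x * fst x - Z (fst x) * fst x" by (simp add: algebra_simps)
    moreover have "fst x * \<bar>w x - Z (fst x)\<bar> \<le> L * \<bar>w x - Z (fst x)\<bar>"
      using True by (intro mult_right_mono) auto
    ultimately show ?thesis by (simp add: algebra_simps)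
  next
    case False
    then have "Z (fst x) = 0" by (intro Z_right) auto
    then show ?thesis using that L_pos by (simp add: algebra_simps)
  qed
  have "(\<integral>x. (1 + fst x) * \<bar>w x - Z (fst x)\<bar> \<partial>cyl) \<le>
    (\<integral>x. (1 + 2 * L) * \<bar>w x - Z (fst x)\<bar> + (w x * fst x - Z (fst x) * fst x) \<partial>cyl)"
  proof (rule integral_mono_AE[OF J_int])
    show "integrable cyl (\<lambda>x. (1 + 2 * L) * \<bar>w x - Z (fst x)\<bar> + (w x * fst x - Z (fst x) * fst x))"
      using d_int[OF w(1)] w(2) int 
      by (intro Bochner_Integration.integrable_add Bochner_Integration.integrable_diff integrable_mult_right)
    show "AE x in cyl. (1 + fst x) * \<bar>w x - Z (fst x)\<bar> \<le> 
      (1 + 2 * L) * \<bar>w x - Z (fst x)\<bar> + (w x * fst x - Z (fst x) * fst x)"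
      using AE_space w(3) by eventually_elim (rule pointwise)
  qed
  also have "\<dots> = (1 + 2 * L) * N + ((\<integral>x. w x * fst x \<partial>cyl) - (\<integral>x. Z (fst x) * fst x \<partial>cyl))"
    unfolding N_def using d_int[OF w(1)] w(2) int
    by (subst Bochner_Integration.integral_add) simp_all
  also have "(\<integral>x. w x * fst x \<partial>cyl) - (\<integral>x. Z (fst x) * fst x \<partial>cyl) = (\<integral>x. w0 x * fst x - Z (fst x) * fst x \<partial>cyl)"
    using impulse w0(2) int by simp
  also have "\<dots> \<le> \<delta>"
    unfolding \<delta>
  proof (rule integral_mono_AE[OF _ J0_int])
    show "integrable cyl (\<lambda>x. w0 x * fst x - Z (fst x) * fst x)" using w0(2) int by simp
    show "AE x in cyl. w0 x * fst x - Z (fst x) * fst x \<le> (1 + fst x) * \<bar>w0 x - Z (fst x)\<bar>"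
      using AE_space
    proof eventually_elim
      case (elim x)
      have "w0 x * fst x - Z (fst x) * fst x = fst x * (w0 x - Z (fst x))" by (simp add: algebra_simps)
      also have "\<dots> \<le> fst x * \<bar>w0 x - Z (fst x)\<bar>"
        using elim by (intro mult_left_mono) (auto simp: S_plus_def)
      also have "\<dots> \<le> (1 + fst x) * \<bar>w0 x - Z (fst x)\<bar>"
        by (intro mult_right_mono) auto
      finally show ?case .
    qed
  qed
  finally have "(\<integral>x. (1 + fst x) * \<bar>w x - Z (fst x)\<bar> \<partial>cyl) \<le> (1 + 2 * L) * N + \<delta>" by simp
  also have "\<dots> \<le> (1 + 2 * L) * ((1 + L + 4 * pi * M) * s + \<delta>) + \<delta>"
    using N L_pos by (intro add_right_mono mult_left_mono) auto
  also have "\<dots> \<le> ((1 + 2 * L) * (1 + L + 4 * pi * M) + 1) * (s + \<delta>)"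
  proof -
    \<comment> \<open>A factor of at least 1 may also multiply \<delta>, which brings s and \<delta>
      under one constant.\<close>
    have "1 \<le> 1 + L + 4 * pi * M" using L_pos M_nonneg by simp
    then have "(1 + 2 * L) * \<delta> * 1 \<le> (1 + 2 * L) * \<delta> * (1 + L + 4 * pi * M)"
      using L_pos \<delta>_nonneg by (intro mult_left_mono) auto
    then show ?thesis using s by (simp add: algebra_simps)
  qed
  finally show "(\<integral>x. (1 + fst x) * \<bar>w x - Z (fst x)\<bar> \<partial>cyl) \<le>
      ((1 + 2 * L) * (1 + L + 4 * pi * M) + 1) * (\<delta> powr (1/2) + \<delta>)" unfolding s_def .
qed

text \<open>Each radius has a radius slightly to its left where the almost-everywhere information
  holds, and monotonicity carries it to the right. The resulting pointwise bound by \<open>M\<close>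
  keeps the extension to the negative half line non-increasing.\<close>

lemma profile_bounds:
  assumes nonneg: "\<And>r. 0 < r \<Longrightarrow> 0 \<le> \<zeta> r" and anti: "antimono_on {0<..} \<zeta>"
    and supp: "supp (\<lambda>x. \<zeta> (fst x)) \<subseteq> {x \<in> S_plus. fst x < L}"
    and le: "Linf_norm (\<lambda>x. \<zeta> (fst x)) \<le> ereal M" and "0 < L"
  shows "monotone_profile (\<lambda>r. if r \<le> 0 then M else \<zeta> r) L M"
proof -
  have anti: "\<zeta> s \<le> \<zeta> r" if "0 < r" "r \<le> s" for r s
    using monotone_onD[OF anti, of r s] that by simp
  have \<zeta>_le: "\<zeta> r \<le> M" if "0 < r" for r
  proof -
    obtain q where "0 < q" "q < r" "\<bar>\<zeta> q\<bar> \<le> M"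
      using AE_cyl_strip[OF AE_le_Linf_norm[OF le], of 0 r] \<open>0 < r\<close> by auto
    then show ?thesis using anti[of q r] by simp
  qed
  moreover have "\<zeta> r = 0" if "L < r" for r
  proof -
    have "AE x in cyl. \<zeta> (fst x) \<noteq> 0 \<longrightarrow> fst x < L"
      using AE_supp[of "\<lambda>x. \<zeta> (fst x)"] by eventually_elim (use supp in auto)
    then obtain q where "L < q" "q < r" "\<zeta> q \<noteq> 0 \<longrightarrow> q < L"
      using AE_cyl_strip[of "\<lambda>q. \<zeta> q \<noteq> 0 \<longrightarrow> q < L" L r] \<open>L < r\<close> \<open>0 < L\<close> by auto
    then show ?thesis using anti[of q r] nonneg[of r] \<open>0 < L\<close> by simp
  qed
  moreover have "0 \<le> M" using \<zeta>_le[of 1] nonneg[of 1] by simp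
  ultimately show ?thesis
    using anti nonneg \<open>0 < L\<close> by unfold_locales (auto simp: antimono_def)
qed

text \<open>Transport by a measure-preserving map supplies the equality of distributions and the
  sign of \<open>\<omega> t\<close>; conservation of the impulse supplies the rest of the static
  comparison.\<close>

lemma euler_solution_stability:
  assumes "monotone_profile Z L M" and "0 \<le> t"
    and \<omega>0: "in_Linf \<omega>0" "AE x in cyl. 0 \<le> \<omega>0 x" "compactly_supported \<omega>0"
    and sol: "euler_solution \<omega>0 \<omega>"
  defines "\<delta> \<equiv> enn2real (J1_norm (\<lambda>x. \<omega>0 x - Z (fst x)))"
  shows "J1_norm (\<lambda>x. \<omega> t x - Z (fst x)) \<le>
    ennreal (((1 + 2 * L) * (1 + L + 4 * pi * M) + 1) * (\<delta> powr (1/2) + \<delta>))"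
proof -
  interpret monotone_profile Z L M by fact
  have [measurable]: "\<omega>0 \<in> borel_measurable cyl" using \<omega>0(1) by (simp add: in_Linf_def)
  obtain X where X: "measure_preserving_map X" "AE x in cyl. \<omega> t (X x) = \<omega>0 x" 
    using sol \<open>0 \<le> t\<close> unfolding euler_solution_def by metis
  then have [measurable]: "X \<in> cyl \<rightarrow>\<^sub>M cyl" by (simp add: measure_preserving_map_def)
  have wt: "integrable cyl (\<omega> t)"
    using sol \<open>0 \<le> t\<close> unfolding euler_solution_def weak_solution_def by metis
  then have [measurable]: "\<omega> t \<in> borel_measurable cyl" by simp
  have equidistributed: "(\<integral>x. f (\<omega> t x) \<partial>cyl) = (\<integral>x. f (\<omega>0 x) \<partial>cyl)"
    if [measurable]: "f \<in> borel_measurable borel" for f :: "real \<Rightarrow> real"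
  proof -
    have "(\<integral>x. f (\<omega> t x) \<partial>cyl) = (\<integral>x. f (\<omega> t (X x)) \<partial>cyl)"
      by (rule measure_preserving_integral[OF X(1), symmetric]) measurable
    also have "\<dots> = (\<integral>x. f (\<omega>0 x) \<partial>cyl)"
      using X(2) by (intro integral_cong_AE) (measurable, auto elim: eventually_mono)
    finally show ?thesis .
  qed
  have wt_nonneg: "AE x in cyl. 0 \<le> \<omega> t x"
  proof (subst measure_preserving_AE[OF X(1), symmetric])
    show "AE x in cyl. 0 \<le> \<omega> t (X x)" using X(2) \<omega>0(2) by eventually_elim simp
  qed measurable
  have w0: "integrable cyl \<omega>0" by (rule euler_solution_integrable[OF sol]) measurable
  obtain R where R: "AE x in cyl. \<omega>0 x \<noteq> 0 \<longrightarrow> fst x \<le> R"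
    using compactly_supported_AE[OF \<omega>0(3)] by blast
  have w0_fst: "integrable cyl (\<lambda>x. \<omega>0 x * fst x)"
  proof (rule integrable_mult_of_support[OF w0])
    show "AE x in cyl. \<omega>0 x \<noteq> 0 \<longrightarrow> \<bar>fst x\<bar> \<le> R"
      using R AE_space by eventually_elim (auto simp: S_plus_def)
  qed measurable
  have wt_fst: "integrable cyl (\<lambda>x. \<omega> t x * fst x)"
    and impulse: "(\<integral>x. \<omega> t x * fst x \<partial>cyl) = (\<integral>x. \<omega>0 x * fst x \<partial>cyl)"
    using impulse_integrable[OF sol _ \<omega>0(3) \<open>0 \<le> t\<close>] impulse_conserved[OF sol _ \<omega>0(3) \<open>0 \<le> t\<close>] by auto
  have J1_eq: "J1_norm (\<lambda>x. f x - Z (fst x)) = ennreal (\<integral>x. (1 + fst x) * \<bar>f x - Z (fst x)\<bar> \<partial>cyl)"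
    if "integrable cyl (\<lambda>x. (1 + fst x) * \<bar>f x - Z (fst x)\<bar>)" for f
    unfolding J1_norm_def using AE_space
    by (intro nn_integral_eq_integral[OF that], eventually_elim) (auto simp: S_plus_def)
  note w0_facts = w0 w0_fst \<omega>0(2)
  \<comment> \<open>Comparing the initial data with itself yields the integrability that makes
    \<open>enn2real\<close> in \<delta> act on a finite value.\<close>
  have J0_int: "integrable cyl (\<lambda>x. (1 + fst x) * \<bar>\<omega>0 x - Z (fst x)\<bar>)"
    by (rule J1_stability(1)[OF w0_facts w0_facts refl refl refl])
  have "0 \<le> (\<integral>x. (1 + fst x) * \<bar>\<omega>0 x - Z (fst x)\<bar> \<partial>cyl)"
    using AE_space by (intro integral_nonneg_AE, eventually_elim) (auto simp: S_plus_def)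
  then have \<delta>: "\<delta> = (\<integral>x. (1 + fst x) * \<bar>\<omega>0 x - Z (fst x)\<bar> \<partial>cyl)"
    unfolding \<delta>_def J1_eq[of \<omega>0, OF J0_int] by simp
  note stab = J1_stability[OF wt wt_fst wt_nonneg w0_facts impulse equidistributed \<delta>]
  have "J1_norm (\<lambda>x. \<omega> t x - Z (fst x)) = ennreal (\<integral>x. (1 + fst x) * \<bar>\<omega> t x - Z (fst x)\<bar> \<partial>cyl)"
    by (rule J1_eq) (rule stab(1))
  also have "\<dots> \<le> ennreal (((1 + 2 * L) * (1 + L + 4 * pi * M) + 1) * (\<delta> powr (1/2) + \<delta>))"
    by (rule ennreal_leI) (rule stab(2))
  finally show ?thesis .
qed

theorem theorem1p1:
  fixes L M :: real
  assumes "L > 0" and "M > 0"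
  shows "\<exists>C1>0. \<forall>\<zeta> :: real \<Rightarrow> real.
    in_Linf (\<lambda>x. \<zeta> (fst x)) \<and>
    (\<forall>r>0. 0 \<le> \<zeta> r) \<and>
    antimono_on {0<..} \<zeta> \<and>
    compactly_supported (\<lambda>x. \<zeta> (fst x)) \<and>
    supp (\<lambda>x. \<zeta> (fst x)) \<subseteq> {x \<in> S_plus. fst x < L} \<and>
    Linf_norm (\<lambda>x. \<zeta> (fst x)) \<le> ereal M \<longrightarrow>
    (\<forall>\<omega>0 \<omega>.
      in_Linf \<omega>0 \<and>
      (AE x in cyl. 0 \<le> \<omega>0 x) \<and>
      compactly_supported \<omega>0 \<and>
      euler_solution \<omega>0 \<omega> \<longrightarrow>
      (let \<delta> = enn2real (J1_norm (\<lambda>x. \<omega>0 x - \<zeta> (fst x))) in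
        (SUP t\<in>{0..}. J1_norm (\<lambda>x. \<omega> t x - \<zeta> (fst x))) \<le> ennreal (C1 * (\<delta> powr (1/2) + \<delta>))))"
proof (intro exI[of _ "(1 + 2 * L) * (1 + L + 4 * pi * M) + 1"] conjI allI impI)
  show "0 < (1 + 2 * L) * (1 + L + 4 * pi * M) + 1"
    using assms by (simp add: add_pos_pos)
next
  fix \<zeta> :: "real \<Rightarrow> real" and \<omega>0 :: "real \<times> real \<Rightarrow> real" and \<omega> :: "real \<Rightarrow> real \<times> real \<Rightarrow> real"
  assume \<zeta>: "in_Linf (\<lambda>x. \<zeta> (fst x)) \<and>
    (\<forall>r>0. 0 \<le> \<zeta> r) \<and>
    antimono_on {0<..} \<zeta> \<and>
    compactly_supported (\<lambda>x. \<zeta> (fst x)) \<and>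
    supp (\<lambda>x. \<zeta> (fst x)) \<subseteq> {x \<in> S_plus. fst x < L} \<and>
    Linf_norm (\<lambda>x. \<zeta> (fst x)) \<le> ereal M"
    and \<omega>: "in_Linf \<omega>0 \<and> (AE x in cyl. 0 \<le> \<omega>0 x) \<and> compactly_supported \<omega>0 \<and> euler_solution \<omega>0 \<omega>"
  define Z where "Z r = (if r \<le> 0 then M else \<zeta> r)" for r
  have Z: "monotone_profile Z L M"
    unfolding Z_def by (rule profile_bounds) (use \<zeta> assms in auto)
  \<comment> \<open>Only positive radii occur in \<open>S_plus\<close>, so the value
    \<open>M\<close> placed on the others affects no norm.\<close>
  have J1_eq: "J1_norm (\<lambda>x. f x - \<zeta> (fst x)) = J1_norm (\<lambda>x. f x - Z (fst x))" for f
    unfolding J1_norm_def by (intro nn_integral_cong) (auto simp: Z_def S_plus_def)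
  show "let \<delta> = enn2real (J1_norm (\<lambda>x. \<omega>0 x - \<zeta> (fst x))) in
      (SUP t\<in>{0..}. J1_norm (\<lambda>x. \<omega> t x - \<zeta> (fst x))) \<le>
      ennreal (((1 + 2 * L) * (1 + L + 4 * pi * M) + 1) * (\<delta> powr (1/2) + \<delta>))"
    unfolding Let_def J1_eq
    by (intro SUP_least euler_solution_stability[OF Z]) (use \<omega> in auto)
qed

end
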